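(* Let $N>2$, let $\Omega\subset\mathbb{R}^N$ be a bounded open set, let $0<\theta<1$ and $0<\alpha\le\beta$. Let $a:\Omega\to\mathbb{R}$ be measurable with $\alpha\le a(x)\le\beta$ for a.e. $x\in\Omega$, and let $M:\Omega\to\mathbb{R}^{N^2}$ be a measurable symmetric matrix with $M(x)\xi\cdot\xi\ge\alpha|\xi|^2$ and $|M(x)|\le\beta$ for a.e. $x\in\Omega$ and every $\xi\in\mathbb{R}^N$. Let $1<r\le\frac{2N}{N+2+(N-2)\theta}$ and let $f\in L^m(\Omega)$, $f\ge0$ a.e., $f$ not a.e. zero, with $m\ge\left(\frac{2^*}{1-\theta}\right)'$. Let $(u,\psi)$ be the solution, obtained by approximation as described in the context, of the system $$\left\{\begin{array}{l} u\in W_0^{1,2}(\Omega),\ u>0:\quad -\operatorname{div}(a(x)\nabla u)+\psi|u|^{r-2}u=\dfrac{f(x)}{u^\theta},\\[2mm] \psi\in W_0^{1,2}(\Omega),\ \psi>0:\quad -\operatorname{div}(M(x)\nabla\psi)=|u|^r.\end{array}\right.$$ Then $(u,\psi)$ is a saddle point of the functional $J$ defined on $W_0^{1,2}(\Omega)\times W_0^{1,2}(\Omega)$ by $$J(v,\varphi)=\frac12\int_\Omega a(x)|\nabla v|^2-\frac1{2r}\int_\Omega M(x)\nabla\varphi\cdot\nabla\varphi+\frac1r\int_\Omega\varphi^+|v|^r-\frac1{1-\theta}\int_\Omega f\,(v^+)^{1-\theta}$$ if $\varphi^+|v|^r\in L^1(\Omega)$, and $J(v,\varphi)=+\infty$ otherwise;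 that is, $$J(u,\varphi)\le J(u,\psi)\le J(v,\psi)\qquad\text{for all } v,\varphi\in W_0^{1,2}(\Omega)\text{ such that }\psi|v|^r\in L^1(\Omega).$$
   Context: For $p>1$, $p'=\frac p{p-1}$; $2^*=\frac{2N}{N-2}$; $s^+=\max(s,0)$. For $k>0$, $T_k(s)=\max(-k,\min(s,k))$. A solution of the system is understood in the distributional sense (test functions in $C_c^1(\Omega)$ in both equations). The solution obtained by approximation is the following. For $n\in\mathbb{N}$ put $f_n=T_n(f)$ and let $(u_n,\psi_n)$, with $u_n,\psi_n\in W_0^{1,2}(\Omega)\cap L^\infty(\Omega)$, $u_n\ge0$, $\psi_n\ge0$, be a weak solution of $$-\operatorname{div}(a(x)\nabla u_n)+\psi_n|u_n|^{r-2}u_n=\frac{f_n}{(\frac1n+u_n)^\theta},\qquad -\operatorname{div}(M(x)\nabla\psi_n)=|u_n|^r .$$ Then $(u,\psi)$ is a solution of the system such that, along a subsequence, $u_n\to u$ and $\psi_n\to\psi$ weakly in $W_0^{1,2}(\Omega)$ and a.e. in $\Omega$. *)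

theory Defs
  imports "HOL-Analysis.Analysis"
begin

text \<open>
  Functions on \<open>\<Omega>\<close> are total functions on \<open>real ^ 'n\<close>, of which only the values on \<open>\<Omega>\<close>, up to
  Lebesgue null sets, matter (all measurability, integrals and a.e. statements use
  \<open>lebesgue_on \<Omega>\<close>). Test functions vanish outside a compact subset of \<open>\<Omega>\<close>.
\<close>

section \<open>Exponents, truncation, Lebesgue spaces\<close>

definition conj_exp :: "real \<Rightarrow> real" where
  "conj_exp p = p / (p - 1)"

definition sobolev_exp :: "nat \<Rightarrow> real" where
  "sobolev_exp N = 2 * real N / (real N - 2)"

definition pos_part :: "real \<Rightarrow> real" where
  "pos_part s = max s 0"

definition truncation :: "real \<Rightarrow> real \<Rightarrow> real" where
  "truncation k s = max (- k) (min s k)"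

definition L_space :: "ereal \<Rightarrow> (real ^ 'n) set \<Rightarrow> (real ^ 'n \<Rightarrow> real) set" where
  "L_space p \<Omega> =
     {f \<in> borel_measurable (lebesgue_on \<Omega>).
        if p = \<infinity> then (\<exists>C. AE x in lebesgue_on \<Omega>. \<bar>f x\<bar> \<le> C)
        else integrable (lebesgue_on \<Omega>) (\<lambda>x. \<bar>f x\<bar> powr real_of_ereal p)}"

section \<open>Test functions, weak gradients, Sobolev spaces\<close>

definition classical_grad :: "(real ^ 'n \<Rightarrow> real) \<Rightarrow> real ^ 'n \<Rightarrow> real ^ 'n" where
  "classical_grad \<phi> x = (\<chi> i. frechet_derivative \<phi> (at x) (axis i 1))"

definition Cc1 :: "(real ^ 'n) set \<Rightarrow> (real ^ 'n \<Rightarrow> real) set" where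
  "Cc1 \<Omega> =
     {\<phi>. \<phi> differentiable_on UNIV \<and> continuous_on UNIV (classical_grad \<phi>) \<and>
         compact (closure {x. \<phi> x \<noteq> 0}) \<and> closure {x. \<phi> x \<noteq> 0} \<subseteq> \<Omega>}"

text \<open>
  Requiring integrability against every test function amounts to local integrability on \<open>\<Omega>\<close>;
  without it the Bochner integrals below would default to 0.
\<close>

definition has_weak_grad ::
    "(real ^ 'n) set \<Rightarrow> (real ^ 'n \<Rightarrow> real) \<Rightarrow> (real ^ 'n \<Rightarrow> real ^ 'n) \<Rightarrow> bool" where
  "has_weak_grad \<Omega> u g \<longleftrightarrow>
     u \<in> borel_measurable (lebesgue_on \<Omega>) \<and> g \<in> borel_measurable (lebesgue_on \<Omega>) \<and>
     (\<forall>\<phi> \<in> Cc1 \<Omega>. integrable (lebesgue_on \<Omega>) (\<lambda>x. \<phi> x * u x) \<and>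
        (\<forall>i. integrable (lebesgue_on \<Omega>) (\<lambda>x. u x * classical_grad \<phi> x $ i) \<and>
             integrable (lebesgue_on \<Omega>) (\<lambda>x. g x $ i * \<phi> x) \<and>
             (LINT x|lebesgue_on \<Omega>. u x * classical_grad \<phi> x $ i) =
             - (LINT x|lebesgue_on \<Omega>. g x $ i * \<phi> x)))"

text \<open>A weak gradient is determined up to a null set of \<open>\<Omega>\<close>; the choice is irrelevant below.\<close>

definition weak_grad :: "(real ^ 'n) set \<Rightarrow> (real ^ 'n \<Rightarrow> real) \<Rightarrow> real ^ 'n \<Rightarrow> real ^ 'n" where
  "weak_grad \<Omega> u = (SOME g. has_weak_grad \<Omega> u g)"

definition W12 :: "(real ^ 'n) set \<Rightarrow> (real ^ 'n \<Rightarrow> real) set" where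
  "W12 \<Omega> = {u \<in> L_space 2 \<Omega>. \<exists>g. has_weak_grad \<Omega> u g \<and> (\<forall>i. (\<lambda>x. g x $ i) \<in> L_space 2 \<Omega>)}"

definition W12_norm :: "(real ^ 'n) set \<Rightarrow> (real ^ 'n \<Rightarrow> real) \<Rightarrow> real" where
  "W12_norm \<Omega> u = sqrt ((LINT x|lebesgue_on \<Omega>. (u x)\<^sup>2) + (LINT x|lebesgue_on \<Omega>. (norm (weak_grad \<Omega> u x))\<^sup>2))"

text \<open>Closure of \<open>C\<^sub>c\<^sup>1(\<Omega>)\<close>, equivalently of the smooth compactly supported functions, in \<open>W\<^sup>1\<^sup>,\<^sup>2(\<Omega>)\<close>.\<close>

definition W012 :: "(real ^ 'n) set \<Rightarrow> (real ^ 'n \<Rightarrow> real) set" where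
  "W012 \<Omega> = {u \<in> W12 \<Omega>. \<forall>\<epsilon>>0. \<exists>\<phi> \<in> Cc1 \<Omega>. W12_norm \<Omega> (\<lambda>x. \<phi> x - u x) < \<epsilon>}"

definition W012_dual :: "(real ^ 'n) set \<Rightarrow> ((real ^ 'n \<Rightarrow> real) \<Rightarrow> real) set" where
  "W012_dual \<Omega> =
     {L. (\<forall>v \<in> W012 \<Omega>. \<forall>w \<in> W012 \<Omega>. L (\<lambda>x. v x + w x) = L v + L w) \<and>
         (\<forall>c. \<forall>v \<in> W012 \<Omega>. L (\<lambda>x. c * v x) = c * L v) \<and>
         (\<exists>C. \<forall>v \<in> W012 \<Omega>. \<bar>L v\<bar> \<le> C * W12_norm \<Omega> v)}"

definition W012_weak_conv ::
    "(real ^ 'n) set \<Rightarrow> (nat \<Rightarrow> real ^ 'n \<Rightarrow> real) \<Rightarrow> (real ^ 'n \<Rightarrow> real) \<Rightarrow> bool" where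
  "W012_weak_conv \<Omega> w v \<longleftrightarrow>
     (\<forall>k. w k \<in> W012 \<Omega>) \<and> v \<in> W012 \<Omega> \<and> (\<forall>L \<in> W012_dual \<Omega>. (\<lambda>k. L (w k)) \<longlonglongrightarrow> L v)"

section \<open>The system, its approximation, and the functional\<close>

definition is_solution ::
    "(real ^ 'n) set \<Rightarrow> (real ^ 'n \<Rightarrow> real) \<Rightarrow> (real ^ 'n \<Rightarrow> real ^ 'n ^ 'n) \<Rightarrow> (real ^ 'n \<Rightarrow> real) \<Rightarrow>
     real \<Rightarrow> real \<Rightarrow> (real ^ 'n \<Rightarrow> real) \<Rightarrow> (real ^ 'n \<Rightarrow> real) \<Rightarrow> bool" where
  "is_solution \<Omega> a M f r \<theta> u \<psi> \<longleftrightarrow>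
     u \<in> W012 \<Omega> \<and> \<psi> \<in> W012 \<Omega> \<and>
     (AE x in lebesgue_on \<Omega>. u x > 0) \<and> (AE x in lebesgue_on \<Omega>. \<psi> x > 0) \<and>
     (\<forall>\<phi> \<in> Cc1 \<Omega>.
        integrable (lebesgue_on \<Omega>) (\<lambda>x. \<psi> x * \<bar>u x\<bar> powr (r - 2) * u x * \<phi> x) \<and>
        integrable (lebesgue_on \<Omega>) (\<lambda>x. f x / u x powr \<theta> * \<phi> x) \<and>
        (LINT x|lebesgue_on \<Omega>. a x * (weak_grad \<Omega> u x \<bullet> classical_grad \<phi> x))
          + (LINT x|lebesgue_on \<Omega>. \<psi> x * \<bar>u x\<bar> powr (r - 2) * u x * \<phi> x)
          = (LINT x|lebesgue_on \<Omega>. f x / u x powr \<theta> * \<phi> x)) \<and>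
     (\<forall>\<phi> \<in> Cc1 \<Omega>.
        integrable (lebesgue_on \<Omega>) (\<lambda>x. \<bar>u x\<bar> powr r * \<phi> x) \<and>
        (LINT x|lebesgue_on \<Omega>. (M x *v weak_grad \<Omega> \<psi> x) \<bullet> classical_grad \<phi> x)
          = (LINT x|lebesgue_on \<Omega>. \<bar>u x\<bar> powr r * \<phi> x))"

text \<open>
  Since \<open>un\<close>, \<open>\<psi>n\<close> and the truncation of \<open>f\<close> are bounded and \<open>\<Omega>\<close> is bounded, all integrands below
  are integrable for every test function in \<open>W012 \<Omega>\<close>. Used for \<open>n \<ge> 1\<close> only.
\<close>

definition is_approx_solution ::
    "(real ^ 'n) set \<Rightarrow> (real ^ 'n \<Rightarrow> real) \<Rightarrow> (real ^ 'n \<Rightarrow> real ^ 'n ^ 'n) \<Rightarrow> (real ^ 'n \<Rightarrow> real) \<Rightarrow>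
     real \<Rightarrow> real \<Rightarrow> nat \<Rightarrow> (real ^ 'n \<Rightarrow> real) \<Rightarrow> (real ^ 'n \<Rightarrow> real) \<Rightarrow> bool" where
  "is_approx_solution \<Omega> a M f r \<theta> n un \<psi>n \<longleftrightarrow>
     un \<in> W012 \<Omega> \<inter> L_space \<infinity> \<Omega> \<and> \<psi>n \<in> W012 \<Omega> \<inter> L_space \<infinity> \<Omega> \<and>
     (AE x in lebesgue_on \<Omega>. un x \<ge> 0) \<and> (AE x in lebesgue_on \<Omega>. \<psi>n x \<ge> 0) \<and>
     (\<forall>v \<in> W012 \<Omega>.
        (LINT x|lebesgue_on \<Omega>. a x * (weak_grad \<Omega> un x \<bullet> weak_grad \<Omega> v x))
          + (LINT x|lebesgue_on \<Omega>. \<psi>n x * \<bar>un x\<bar> powr (r - 2) * un x * v x)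
          = (LINT x|lebesgue_on \<Omega>. truncation (real n) (f x) / (1 / real n + un x) powr \<theta> * v x)) \<and>
     (\<forall>v \<in> W012 \<Omega>.
        (LINT x|lebesgue_on \<Omega>. (M x *v weak_grad \<Omega> \<psi>n x) \<bullet> weak_grad \<Omega> v x)
          = (LINT x|lebesgue_on \<Omega>. \<bar>un x\<bar> powr r * v x))"

definition is_solution_by_approximation ::
    "(real ^ 'n) set \<Rightarrow> (real ^ 'n \<Rightarrow> real) \<Rightarrow> (real ^ 'n \<Rightarrow> real ^ 'n ^ 'n) \<Rightarrow> (real ^ 'n \<Rightarrow> real) \<Rightarrow>
     real \<Rightarrow> real \<Rightarrow> (real ^ 'n \<Rightarrow> real) \<Rightarrow> (real ^ 'n \<Rightarrow> real) \<Rightarrow> bool" where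
  "is_solution_by_approximation \<Omega> a M f r \<theta> u \<psi> \<longleftrightarrow>
     is_solution \<Omega> a M f r \<theta> u \<psi> \<and>
     (\<exists>us \<psi>s s.
        (\<forall>n\<ge>1. is_approx_solution \<Omega> a M f r \<theta> n (us n) (\<psi>s n)) \<and>
        strict_mono (s :: nat \<Rightarrow> nat) \<and> (\<forall>k. s k \<ge> 1) \<and>
        W012_weak_conv \<Omega> (\<lambda>k. us (s k)) u \<and> W012_weak_conv \<Omega> (\<lambda>k. \<psi>s (s k)) \<psi> \<and>
        (AE x in lebesgue_on \<Omega>. (\<lambda>k. us (s k) x) \<longlonglongrightarrow> u x) \<and>
        (AE x in lebesgue_on \<Omega>. (\<lambda>k. \<psi>s (s k) x) \<longlonglongrightarrow> \<psi> x))"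

definition J_functional ::
    "(real ^ 'n) set \<Rightarrow> (real ^ 'n \<Rightarrow> real) \<Rightarrow> (real ^ 'n \<Rightarrow> real ^ 'n ^ 'n) \<Rightarrow> (real ^ 'n \<Rightarrow> real) \<Rightarrow>
     real \<Rightarrow> real \<Rightarrow> (real ^ 'n \<Rightarrow> real) \<Rightarrow> (real ^ 'n \<Rightarrow> real) \<Rightarrow> ereal" where
  "J_functional \<Omega> a M f r \<theta> v \<phi> =
     (if integrable (lebesgue_on \<Omega>) (\<lambda>x. pos_part (\<phi> x) * \<bar>v x\<bar> powr r)
      then ereal (1 / 2 * (LINT x|lebesgue_on \<Omega>. a x * (norm (weak_grad \<Omega> v x))\<^sup>2)
             - 1 / (2 * r) * (LINT x|lebesgue_on \<Omega>. (M x *v weak_grad \<Omega> \<phi> x) \<bullet> weak_grad \<Omega> \<phi> x)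
             + 1 / r * (LINT x|lebesgue_on \<Omega>. pos_part (\<phi> x) * \<bar>v x\<bar> powr r)
             - 1 / (1 - \<theta>) * (LINT x|lebesgue_on \<Omega>. f x * pos_part (v x) powr (1 - \<theta>)))
      else \<infinity>)"

end

theory Submission
  imports Defs
begin

text \<open>
  Write \<open>Q w\<close> for the integral of \<open>M \<nabla>w \<bullet> \<nabla>w\<close>. Both inequalities are convexity inequalities at the
  critical point \<open>(u, \<psi>)\<close>, and they follow at once if the two equations may be tested with the
  positive parts of functions in \<open>W012 \<Omega>\<close>.

  In the second variable, the equation for \<open>\<psi>\<close> tested with \<open>\<phi>\<^sup>+\<close> says that the integral of \<open>|u|\<^sup>r \<phi>\<^sup>+\<close>
  equals that of \<open>M \<nabla>\<psi> \<bullet> \<nabla>\<phi>\<close> over \<open>{\<phi> > 0}\<close>. By Young's inequality for the symmetric form \<open>M\<close> this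
  is at most \<open>(Q \<psi> + Q \<phi>) / 2\<close>, and for \<open>\<phi> = \<psi>\<close> it is exactly \<open>Q \<psi>\<close>; the comparison of
  \<open>J(u, \<phi>)\<close> with \<open>J(u, \<psi>)\<close> is a rearrangement (lemma \<open>potential_maximizes\<close>). In the first variable,
  one adds the tangent inequalities at \<open>u\<close> of the convex functions \<open>a |p|\<^sup>2 / 2\<close>, \<open>\<psi> t\<^sup>r / r\<close> and
  \<open>- f t\<^sup>1\<^sup>-\<^sup>\<theta> / (1 - \<theta>)\<close>, taken at \<open>\<nabla>v\<close> restricted to \<open>{v > 0}\<close> and at \<open>t = v\<^sup>+\<close>. The sum of the linear
  terms is the first equation tested with \<open>v\<^sup>+\<close> minus the same equation tested with \<open>u\<close>, which is 0
  (lemma \<open>state_minimizes\<close>). The tangent inequality also bounds \<open>f (v\<^sup>+)\<^sup>1\<^sup>-\<^sup>\<theta>\<close> by integrable functions, so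
  that the last integral in \<open>J\<close> is a genuine one.

  The difficulty is the choice of test functions: the equations hold for \<open>C\<^sub>c\<^sup>1\<close> functions, and the
  densities \<open>f / u\<^sup>\<theta>\<close>, \<open>\<psi> u\<^sup>r\<^sup>-\<^sup>1\<close> and \<open>|u|\<^sup>r\<close> are known to be integrable only against those. Lemma
  \<open>test_positive_part\<close> extends an equation \<open>- div A + G = F\<close> with \<open>A\<close> square integrable and
  \<open>F, G \<ge> 0\<close> to the test function \<open>v\<^sup>+\<close>, for every \<open>v\<close> in \<open>W012 \<Omega>\<close> such that \<open>G v\<^sup>+\<close> is integrable. The
  argument is that of Brezis and Browder. Functions \<open>\<phi>\<^sub>k\<close> in \<open>C\<^sub>c\<^sup>1\<close> that converge to \<open>v\<close> in the
  Sobolev norm need not be dominated by \<open>v\<close>; but a smooth version of the minimum of \<open>\<phi>\<^sub>k\<^sup>+\<close> and \<open>v\<^sup>+\<close> is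
  dominated, up to a factor 2, both by \<open>|\<phi>\<^sub>k|\<close>, which has compact support, and by \<open>v\<^sup>+\<close>. The first
  bound allows to replace \<open>v\<close> in it by \<open>\<phi>\<^sub>j\<close> and let \<open>j\<close> tend to infinity for fixed \<open>k\<close>, and the second one allows \<open>k\<close> to
  tend to infinity: the term with \<open>G\<close> converges by dominated convergence, then \<open>F v\<^sup>+\<close> is integrable by
  Fatou's lemma, and then the term with \<open>F\<close> converges by dominated convergence too. What is inserted
  in the equation is always an explicit \<open>C\<^sup>1\<close> expression in \<open>\<phi>\<^sub>k\<close> and \<open>\<phi>\<^sub>j\<close>, so that only the classical
  chain rule enters.

  Since \<open>weak_grad\<close> is an arbitrary choice among the weak gradients, all of this rests on their
  uniqueness up to null sets, lemma \<open>has_weak_grad_unique\<close>.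
\<close>

section \<open>Continuously differentiable functions\<close>

text \<open>
  Carrying the gradient as a second argument lets the rules below compute it together with the
  function; \<open>classical_grad\<close> is recovered from it by uniqueness of derivatives.
\<close>

definition C1_with_grad :: "(real ^ 'n \<Rightarrow> real) \<Rightarrow> (real ^ 'n \<Rightarrow> real ^ 'n) \<Rightarrow> bool" where
  "C1_with_grad h g \<longleftrightarrow> continuous_on UNIV g \<and> (\<forall>x. (h has_derivative (\<lambda>y. g x \<bullet> y)) (at x))"

lemma C1_with_grad_continuous:
  assumes "C1_with_grad h g"
  shows "continuous_on UNIV h"
  using assms unfolding C1_with_grad_def
  by (meson continuous_at_imp_continuous_on has_derivative_continuous)

lemma C1_with_grad_unique:
  assumes "C1_with_grad h g"
  shows "classical_grad h = g"
proof
  fix x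
  have "frechet_derivative h (at x) = (\<lambda>y. g x \<bullet> y)"
    using assms unfolding C1_with_grad_def by (metis frechet_derivative_at)
  then show "classical_grad h x = g x"
    by (simp add: classical_grad_def vec_eq_iff inner_axis)
qed

lemma C1_with_grad_const: "C1_with_grad (\<lambda>x. c) (\<lambda>x. 0)"
  unfolding C1_with_grad_def
  by (auto intro!: has_derivative_eq_rhs[OF has_derivative_const])

lemma C1_with_grad_inner: "C1_with_grad (\<lambda>x. x \<bullet> b) (\<lambda>x. b)"
  unfolding C1_with_grad_def by (auto intro!: derivative_eq_intros simp: inner_commute)

lemma C1_with_grad_dist_square: "C1_with_grad (\<lambda>x. (x - c) \<bullet> (x - c)) (\<lambda>x. 2 *\<^sub>R (x - c))"
  unfolding C1_with_grad_def
  by (auto intro!: derivative_eq_intros continuous_intros simp: inner_commute)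

lemma C1_with_grad_add:
  assumes "C1_with_grad h g" "C1_with_grad k j"
  shows "C1_with_grad (\<lambda>x. h x + k x) (\<lambda>x. g x + j x)"
  using assms unfolding C1_with_grad_def
  by (auto intro!: derivative_eq_intros continuous_intros simp: inner_add_left)

lemma C1_with_grad_mult:
  assumes "C1_with_grad h g" "C1_with_grad k j"
  shows "C1_with_grad (\<lambda>x. h x * k x) (\<lambda>x. k x *\<^sub>R g x + h x *\<^sub>R j x)"
proof -
  have "((\<lambda>x. h x * k x) has_derivative (\<lambda>y. (k x *\<^sub>R g x + h x *\<^sub>R j x) \<bullet> y)) (at x)" for x
  proof -
    have "((\<lambda>x. h x * k x) has_derivative (\<lambda>y. h x * (j x \<bullet> y) + (g x \<bullet> y) * k x)) (at x)"
      using assms unfolding C1_with_grad_def by (intro has_derivative_mult) auto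
    then show ?thesis by (simp add: inner_add_left algebra_simps)
  qed
  then show ?thesis
    using assms C1_with_grad_continuous[OF assms(1)] C1_with_grad_continuous[OF assms(2)]
    unfolding C1_with_grad_def by (auto intro!: continuous_intros)
qed

lemma C1_with_grad_compose:
  assumes "C1_with_grad h g"
    and "\<And>x. (F has_field_derivative F' (h x)) (at (h x))"
    and "continuous_on (range h) F'"
  shows "C1_with_grad (\<lambda>x. F (h x)) (\<lambda>x. F' (h x) *\<^sub>R g x)"
proof -
  have "((\<lambda>x. F (h x)) has_derivative (\<lambda>y. (F' (h x) *\<^sub>R g x) \<bullet> y)) (at x)" for x
  proof -
    have "(h has_derivative (\<lambda>y. g x \<bullet> y)) (at x)"
      using assms(1) unfolding C1_with_grad_def by auto
    moreover have "(F has_derivative (\<lambda>t. F' (h x) * t)) (at (h x))"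
      using assms(2)[of x] by (simp add: has_field_derivative_def)
    ultimately have "(F \<circ> h has_derivative (\<lambda>t. F' (h x) * t) \<circ> (\<lambda>y. g x \<bullet> y)) (at x)"
      by (rule diff_chain_at)
    then show ?thesis by (simp add: o_def)
  qed
  moreover have "continuous_on UNIV (\<lambda>x. F' (h x))"
    using continuous_on_compose[OF C1_with_grad_continuous[OF assms(1)], of F'] assms(3)
    by (simp add: o_def)
  ultimately show ?thesis
    using assms(1) unfolding C1_with_grad_def
    by (auto intro!: continuous_intros simp del: inner_scaleR_left)
qed

text \<open>
  The square removes the corner of the positive part at 0. This is the source of all cut-offs that
  are used below: they are \<open>C\<^sup>1\<close> and vanish exactly on a prescribed set.
\<close>

lemma DERIV_square_pos_part:
  "((\<lambda>s::real. (max s 0)\<^sup>2) has_field_derivative 2 * max s 0) (at s)"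
proof -
  consider "s < 0" | "s = 0" | "s > 0" by linarith
  then show ?thesis
  proof cases
    case 1
    have "((\<lambda>s::real. 0) has_field_derivative 2 * max s 0) (at s)" using 1 by simp
    then show ?thesis
      by (rule has_field_derivative_transform_within_open[of _ _ _ "{..<0}"]) (use 1 in auto)
  next
    case 2
    have "((\<lambda>h::real. (max h 0)\<^sup>2 / h) \<longlongrightarrow> 0) (at 0)"
    proof (rule Lim_null_comparison)
      show "\<forall>\<^sub>F h in at (0::real). norm ((max h 0)\<^sup>2 / h) \<le> \<bar>h\<bar>"
        by (intro always_eventually) (auto simp: max_def power2_eq_square)
      show "((\<lambda>h::real. \<bar>h\<bar>) \<longlongrightarrow> 0) (at 0)"
        by (intro tendsto_rabs_zero tendsto_ident_at)
    qed
    then show ?thesis using 2 by (simp add: DERIV_def)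
  next
    case 3
    have "((\<lambda>s::real. s\<^sup>2) has_field_derivative 2 * max s 0) (at s)"
      using 3 by (auto intro!: derivative_eq_intros)
    then show ?thesis
      by (rule has_field_derivative_transform_within_open[of _ _ _ "{0<..}"]) (use 3 in auto)
  qed
qed

lemma C1_with_grad_square_pos_part:
  assumes "C1_with_grad h g"
  shows "C1_with_grad (\<lambda>x. (max (h x) 0)\<^sup>2) (\<lambda>x. (2 * max (h x) 0) *\<^sub>R g x)"
  by (rule C1_with_grad_compose[OF assms, of "\<lambda>s. (max s 0)\<^sup>2" "\<lambda>s. 2 * max s 0"])
     (auto intro!: DERIV_square_pos_part continuous_intros)

lemma C1_with_grad_inverse:
  assumes "C1_with_grad h g" and "\<And>x. h x \<noteq> 0"
  shows "C1_with_grad (\<lambda>x. inverse (h x)) (\<lambda>x. (- (inverse (h x))\<^sup>2) *\<^sub>R g x)"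
proof (rule C1_with_grad_compose[OF assms(1), of "inverse" "\<lambda>t. - (inverse t)\<^sup>2"])
  show "(inverse has_field_derivative - (inverse (h x))\<^sup>2) (at (h x))" for x
    using DERIV_inverse[of "h x"] assms(2)[of x] by (simp add: power2_eq_square power_inverse)
  show "continuous_on (range h) (\<lambda>t. - (inverse t)\<^sup>2)"
    using assms(2) by (auto intro!: continuous_intros)
qed

section \<open>Test functions\<close>

lemma Cc1_C1_with_grad:
  assumes "\<phi> \<in> Cc1 \<Omega>"
  shows "C1_with_grad \<phi> (classical_grad \<phi>)"
proof -
  have "(\<phi> has_derivative (\<lambda>y. classical_grad \<phi> x \<bullet> y)) (at x)" for x
  proof -
    have "\<phi> differentiable (at x)"
      using assms by (auto simp: Cc1_def differentiable_on_def)
    then have d: "(\<phi> has_derivative frechet_derivative \<phi> (at x)) (at x)"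
      by (simp add: frechet_derivative_works)
    then interpret linear "frechet_derivative \<phi> (at x)"
      by (rule has_derivative_linear)
    have "frechet_derivative \<phi> (at x) y = classical_grad \<phi> x \<bullet> y" for y
    proof -
      have "frechet_derivative \<phi> (at x) (\<Sum>i\<in>UNIV. y $ i *\<^sub>R axis i 1) =
            (\<Sum>i\<in>UNIV. y $ i *\<^sub>R frechet_derivative \<phi> (at x) (axis i 1))"
        by (simp add: sum scale)
      moreover have "(\<Sum>i\<in>UNIV. y $ i *\<^sub>R axis i 1) = y"
        using basis_expansion[of y] by (simp add: scalar_mult_eq_scaleR)
      ultimately show ?thesis
        by (simp add: classical_grad_def inner_vec_def mult.commute)
    qed
    then have "frechet_derivative \<phi> (at x) = (\<lambda>y. classical_grad \<phi> x \<bullet> y)" by blast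
    then show ?thesis using d by simp
  qed
  then show ?thesis using assms by (auto simp: C1_with_grad_def Cc1_def)
qed

lemma Cc1I:
  assumes "C1_with_grad h g" and "compact K" "K \<subseteq> \<Omega>" "\<And>x. x \<notin> K \<Longrightarrow> h x = 0"
  shows "h \<in> Cc1 \<Omega>" and "classical_grad h = g"
proof -
  show g: "classical_grad h = g" by (rule C1_with_grad_unique[OF assms(1)])
  have K: "closure {x. h x \<noteq> 0} \<subseteq> K"
    using assms(4) compact_imp_closed[OF assms(2)] by (intro closure_minimal) auto
  then have "compact (closure {x. h x \<noteq> 0})"
    using assms(2) by (meson bounded_subset closed_closure compact_eq_bounded_closed)
  moreover have "h differentiable_on UNIV"
    using assms(1) unfolding C1_with_grad_def differentiable_on_def differentiable_def by auto
  ultimately show "h \<in> Cc1 \<Omega>"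
    using K g assms(1,3) by (auto simp: Cc1_def C1_with_grad_def)
qed

lemma Cc1_support:
  assumes "\<phi> \<in> Cc1 \<Omega>"
  shows "\<exists>K. compact K \<and> K \<subseteq> \<Omega> \<and> (\<forall>x. x \<notin> K \<longrightarrow> \<phi> x = 0 \<and> classical_grad \<phi> x = 0)"
proof (intro exI conjI allI impI)
  let ?K = "closure {x. \<phi> x \<noteq> 0}"
  show "compact ?K" "?K \<subseteq> \<Omega>" using assms by (auto simp: Cc1_def)
  show z: "\<phi> x = 0" if "x \<notin> ?K" for x
    using that closure_subset[of "{x. \<phi> x \<noteq> 0}"] by auto
  show "classical_grad \<phi> x = 0" if "x \<notin> ?K" for x
  proof -
    have "(\<phi> has_derivative (\<lambda>y. classical_grad \<phi> x \<bullet> y)) (at x)"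
      using Cc1_C1_with_grad[OF assms] by (simp add: C1_with_grad_def)
    moreover have "(\<phi> has_derivative (\<lambda>y. 0)) (at x)"
    proof (rule has_derivative_transform_within_open[of "\<lambda>x. 0"])
      show "open (- ?K)" "x \<in> - ?K" using that by auto
      show "\<And>y. y \<in> - ?K \<Longrightarrow> 0 = \<phi> y" by (metis ComplD z)
    qed auto
    ultimately have "(\<lambda>y. classical_grad \<phi> x \<bullet> y) = (\<lambda>y. 0)"
      by (rule has_derivative_unique)
    then have "classical_grad \<phi> x \<bullet> classical_grad \<phi> x = 0" by (rule fun_cong)
    then show ?thesis by simp
  qed
qed

lemma Cc1_mult:
  assumes "\<phi> \<in> Cc1 \<Omega>" and "C1_with_grad h g"
  shows "(\<lambda>x. \<phi> x * h x) \<in> Cc1 \<Omega>"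
    and "classical_grad (\<lambda>x. \<phi> x * h x) = (\<lambda>x. h x *\<^sub>R classical_grad \<phi> x + \<phi> x *\<^sub>R g x)"
proof -
  obtain K where "compact K" "K \<subseteq> \<Omega>" "\<And>x. x \<notin> K \<Longrightarrow> \<phi> x = 0"
    using Cc1_support[OF assms(1)] by blast
  then show "(\<lambda>x. \<phi> x * h x) \<in> Cc1 \<Omega>"
    and "classical_grad (\<lambda>x. \<phi> x * h x) = (\<lambda>x. h x *\<^sub>R classical_grad \<phi> x + \<phi> x *\<^sub>R g x)"
    using Cc1I[OF C1_with_grad_mult[OF Cc1_C1_with_grad[OF assms(1)] assms(2)], of K \<Omega>] by auto
qed

lemma continuous_zero_off_compact_bounded:
  fixes g :: "real ^ 'n \<Rightarrow> 'b::real_normed_vector"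
  assumes "continuous_on UNIV g" "compact K" "\<And>x. x \<notin> K \<Longrightarrow> g x = 0"
  obtains B where "B \<ge> 0" "\<And>x. norm (g x) \<le> B"
proof -
  have "compact (g ` K)"
    using assms(1,2) by (meson compact_continuous_image continuous_on_subset subset_UNIV)
  then obtain B where B: "\<And>x. x \<in> K \<Longrightarrow> norm (g x) \<le> B"
    by (meson bounded_iff compact_imp_bounded imageI)
  show ?thesis
  proof
    show "\<bar>B\<bar> \<ge> 0" by simp
    show "norm (g x) \<le> \<bar>B\<bar>" for x
      using B[of x] assms(3)[of x] by (cases "x \<in> K") (auto intro: order_trans)
  qed
qed

lemma Cc1_bounded:
  assumes "\<phi> \<in> Cc1 \<Omega>"
  obtains B where "B \<ge> 0" "\<And>x. \<bar>\<phi> x\<bar> \<le> B" "\<And>x. norm (classical_grad \<phi> x) \<le> B"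
proof -
  note c = Cc1_C1_with_grad[OF assms]
  obtain K where K: "compact K" "K \<subseteq> \<Omega>" "\<And>x. x \<notin> K \<Longrightarrow> \<phi> x = 0"
    "\<And>x. x \<notin> K \<Longrightarrow> classical_grad \<phi> x = 0"
    using Cc1_support[OF assms] by blast
  obtain B1 where B1: "B1 \<ge> 0" "\<And>x. norm (\<phi> x) \<le> B1"
    by (rule continuous_zero_off_compact_bounded[OF C1_with_grad_continuous[OF c] K(1,3)]) auto
  have "continuous_on UNIV (classical_grad \<phi>)" using c by (simp add: C1_with_grad_def)
  then obtain B2 where B2: "B2 \<ge> 0" "\<And>x. norm (classical_grad \<phi> x) \<le> B2"
    by (rule continuous_zero_off_compact_bounded[OF _ K(1,4)]) auto
  show ?thesis
    by (rule that[of "max B1 B2"]) (use B1 B2 in \<open>auto simp: le_max_iff_disj\<close>)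
qed

lemma Cc1_continuous:
  assumes "\<phi> \<in> Cc1 \<Omega>"
  shows "continuous_on UNIV \<phi>" "continuous_on UNIV (classical_grad \<phi>)"
  using Cc1_C1_with_grad[OF assms] C1_with_grad_continuous by (auto simp: C1_with_grad_def)

lemma Cc1_measurable:
  assumes "\<phi> \<in> Cc1 \<Omega>"
  shows "\<phi> \<in> borel_measurable (lebesgue_on S)" "classical_grad \<phi> \<in> borel_measurable (lebesgue_on S)"
proof -
  have "\<phi> \<in> borel_measurable borel" "classical_grad \<phi> \<in> borel_measurable borel"
    using Cc1_continuous[OF assms] by (auto intro: borel_measurable_continuous_onI)
  then show "\<phi> \<in> borel_measurable (lebesgue_on S)"
      "classical_grad \<phi> \<in> borel_measurable (lebesgue_on S)"
    by (auto intro!: measurable_restrict_space1 measurable_completion)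
qed

lemma integrable_times_bounded:
  fixes f g :: "'a \<Rightarrow> real"
  assumes "integrable M f" "g \<in> borel_measurable M" "AE x in M. \<bar>g x\<bar> \<le> B"
  shows "integrable M (\<lambda>x. f x * g x)" "integrable M (\<lambda>x. g x * f x)"
proof -
  show "integrable M (\<lambda>x. f x * g x)"
  proof (rule Bochner_Integration.integrable_bound)
    show "integrable M (\<lambda>x. f x * B)" using assms(1) by simp
    show "(\<lambda>x. f x * g x) \<in> borel_measurable M"
      using borel_measurable_integrable[OF assms(1)] assms(2) by measurable
    show "AE x in M. norm (f x * g x) \<le> norm (f x * B)"
      using assms(3) by eventually_elim (auto simp: abs_mult intro!: mult_left_mono)
  qed
  then show "integrable M (\<lambda>x. g x * f x)" by (simp add: mult.commute)
qed

lemma integral_zero_off_subset: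
  fixes h :: "real ^ 'n \<Rightarrow> real"
  assumes "open \<Omega>" "\<And>x. x \<notin> \<Omega> \<Longrightarrow> h x = 0" "h \<in> borel_measurable borel"
  shows "(LINT x|lebesgue_on \<Omega>. h x) = (LINT x|lborel. h x)"
    and "integrable (lebesgue_on \<Omega>) h \<longleftrightarrow> integrable lborel h"
proof -
  have e: "indicator \<Omega> x *\<^sub>R h x = h x" for x using assms(2)[of x] by (cases "x \<in> \<Omega>") auto
  show "(LINT x|lebesgue_on \<Omega>. h x) = (LINT x|lborel. h x)"
    using assms(1,3) by (subst integral_restrict_space) (simp_all only: e, auto simp: integral_completion)
  show "integrable (lebesgue_on \<Omega>) h \<longleftrightarrow> integrable lborel h"
    using assms(1,3) by (subst integrable_restrict_space) (simp_all only: e, auto simp: integrable_completion)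
qed

lemma integrable_continuous_compact_support:
  fixes h :: "real ^ 'n \<Rightarrow> real"
  assumes "continuous_on UNIV h" "compact K" "\<And>x. x \<notin> K \<Longrightarrow> h x = 0"
  shows "integrable lborel h"
proof -
  have "integrable lborel (\<lambda>x. indicator K x *\<^sub>R h x)"
    by (intro borel_integrable_compact assms(2) continuous_on_subset[OF assms(1)]) auto
  moreover have "(\<lambda>x. indicator K x *\<^sub>R h x) = h"
    using assms(3) by (fastforce simp: indicator_def)
  ultimately show ?thesis by simp
qed

lemma borel_measurable_vec_nth_comp:
  fixes g :: "'a \<Rightarrow> real ^ 'n"
  assumes "g \<in> borel_measurable M"
  shows "(\<lambda>x. g x $ i) \<in> borel_measurable M"
  using borel_measurable_inner[OF assms borel_measurable_const[of "axis i 1"]]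
  by (simp add: inner_axis)

section \<open>Integration by parts and uniqueness of weak gradients\<close>

lemma lborel_integral_translation:
  fixes h :: "real ^ 'n \<Rightarrow> real"
  assumes "h \<in> borel_measurable borel"
  shows "(LINT x|lborel. h (c + x)) = (LINT x|lborel. h x)"
    and "integrable lborel (\<lambda>x. h (c + x)) \<longleftrightarrow> integrable lborel h"
proof -
  have m: "(+) c \<in> measurable lborel borel" by simp
  show "(LINT x|lborel. h (c + x)) = (LINT x|lborel. h x)"
    using integral_distr[OF m assms] lborel_distr_plus[of c] by simp
  show "integrable lborel (\<lambda>x. h (c + x)) \<longleftrightarrow> integrable lborel h"
    using integrable_distr_eq[OF m assms] lborel_distr_plus[of c] by simp
qed

lemma Cc1_lipschitz:
  fixes h :: "real ^ 'n \<Rightarrow> real"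
  assumes "h \<in> Cc1 \<Omega>" and "\<And>x. norm (classical_grad h x) \<le> B"
  shows "\<bar>h x - h y\<bar> \<le> B * norm (x - y)"
proof -
  have "norm (h x - h y) \<le> B * norm (x - y)"
  proof (rule differentiable_bound[of UNIV h "\<lambda>x y. classical_grad h x \<bullet> y"])
    show "(h has_derivative (\<lambda>y. classical_grad h x \<bullet> y)) (at x within UNIV)" for x
      using Cc1_C1_with_grad[OF assms(1)] by (simp add: C1_with_grad_def)
    show "onorm (\<lambda>y. classical_grad h x \<bullet> y) \<le> B" for x
    proof (rule onorm_bound)
      show "0 \<le> B" using assms(2)[of 0] norm_ge_zero order_trans by blast
      show "norm (classical_grad h x \<bullet> y) \<le> B * norm y" for y
        using Cauchy_Schwarz_ineq2[of "classical_grad h x" y] mult_right_mono[OF assms(2)[of x], of "norm y"]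
        by simp
    qed
  qed auto
  then show ?thesis by simp
qed

text \<open>
  Translation invariance makes the integral of every difference quotient in the direction of the
  \<open>i\<close>-th axis vanish. The quotients are bounded by the Lipschitz constant and, for steps of length at
  most 1, supported in one ball, so the limit can be taken under the integral.
\<close>

lemma integral_partial_derivative_Cc1:
  fixes h :: "real ^ 'n \<Rightarrow> real"
  assumes "h \<in> Cc1 \<Omega>"
  shows "(LINT x|lborel. classical_grad h x $ i) = 0"
proof -
  define e :: "real ^ 'n" where "e = axis i 1"
  \<comment> \<open>The steps lie in \<open>(0, 1]\<close>, which is why the dominating function lives on a ball of radius \<open>R + 1\<close>.\<close>
  define t :: "nat \<Rightarrow> real" where "t n = 1 / real (Suc n)" for n
  define D where "D n x = (h (t n *\<^sub>R e + x) - h x) / t n" for n x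
  have t: "t n > 0" "t n \<le> 1" for n by (auto simp: t_def)
  have ne: "norm e = 1" by (simp add: e_def)
  have hm: "h \<in> borel_measurable borel"
    using Cc1_continuous[OF assms] by (auto intro: borel_measurable_continuous_onI)
  have gm: "classical_grad h \<in> borel_measurable borel"
    using Cc1_continuous[OF assms] by (auto intro: borel_measurable_continuous_onI)
  obtain K where K: "compact K" "\<And>x. x \<notin> K \<Longrightarrow> h x = 0" "\<And>x. x \<notin> K \<Longrightarrow> classical_grad h x = 0"
    using Cc1_support[OF assms] by blast
  obtain B where B: "B \<ge> 0" "\<And>x. \<bar>h x\<bar> \<le> B" "\<And>x. norm (classical_grad h x) \<le> B"
    by (rule Cc1_bounded[OF assms]) blast
  obtain R where R: "\<And>x. x \<in> K \<Longrightarrow> norm x \<le> R"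
    using K(1) compact_imp_bounded bounded_iff by metis
  have hi: "integrable lborel h"
    by (rule integrable_continuous_compact_support[OF Cc1_continuous(1)[OF assms] K(1,2)])
  have D0: "(LINT x|lborel. D n x) = 0" for n
    using lborel_integral_translation[OF hm, of "t n *\<^sub>R e"] hi by (simp add: D_def)
  have "(\<lambda>n. LINT x|lborel. D n x) \<longlonglongrightarrow> (LINT x|lborel. classical_grad h x $ i)"
  proof (rule integral_dominated_convergence[where w = "\<lambda>x. B * indicator (cball 0 (R + 1)) x"])
    show "(\<lambda>x. classical_grad h x $ i) \<in> borel_measurable lborel"
      using borel_measurable_continuous_onI[of "\<lambda>x. classical_grad h x $ i"] Cc1_continuous(2)[OF assms]
      by (auto intro!: continuous_intros)
    show "D n \<in> borel_measurable lborel" for n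
      unfolding D_def using hm by measurable
    show "integrable lborel (\<lambda>x. B * indicator (cball (0::real^'n) (R + 1)) x)"
      by (intro integrable_mult_right integrable_real_indicator)
         (use emeasure_lborel_cball_finite[of "0::real^'n" "R + 1"] in auto)
    show "AE x in lborel. (\<lambda>n. D n x) \<longlonglongrightarrow> classical_grad h x $ i"
    proof (rule AE_I2)
      fix x
      have "(h has_derivative (\<lambda>y. classical_grad h x \<bullet> y)) (at (0 *\<^sub>R e + x))"
        using Cc1_C1_with_grad[OF assms] by (simp add: C1_with_grad_def)
      moreover have "((\<lambda>s. s *\<^sub>R e + x) has_derivative (\<lambda>s. s *\<^sub>R e)) (at 0)"
        by (auto intro!: derivative_eq_intros)
      ultimately have "(h \<circ> (\<lambda>s. s *\<^sub>R e + x) has_derivative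
          (\<lambda>y. classical_grad h x \<bullet> y) \<circ> (\<lambda>s. s *\<^sub>R e)) (at 0)"
        by (intro diff_chain_at)
      then have "((\<lambda>s. h (s *\<^sub>R e + x)) has_derivative (\<lambda>s. classical_grad h x \<bullet> (s *\<^sub>R e))) (at 0)"
        by (simp only: o_def)
      then have "((\<lambda>s. h (s *\<^sub>R e + x)) has_field_derivative (classical_grad h x \<bullet> e)) (at 0)"
        by (simp add: has_field_derivative_def mult.commute[of _ "classical_grad h x \<bullet> e"] mult_commute_abs)
      then have "((\<lambda>s. (h (s *\<^sub>R e + x) - h x) / s) \<longlongrightarrow> classical_grad h x $ i) (at 0)"
        by (simp add: DERIV_def e_def inner_axis)
      moreover have "filterlim t (at 0) sequentially"
      proof (rule filterlim_atI)
        show "t \<longlonglongrightarrow> 0" unfolding t_def by (rule LIMSEQ_Suc[OF lim_1_over_n])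
      qed (use t in \<open>auto simp: less_imp_neq[symmetric]\<close>)
      ultimately show "(\<lambda>n. D n x) \<longlonglongrightarrow> classical_grad h x $ i"
        unfolding D_def by (rule filterlim_compose)
    qed
    show "AE x in lborel. norm (D n x) \<le> B * indicator (cball 0 (R + 1)) x" for n
    proof (rule AE_I2)
      fix x
      have *: "\<bar>D n x\<bar> \<le> B"
        using Cc1_lipschitz[OF assms B(3), of "t n *\<^sub>R e + x" x] t[of n] ne
        by (simp add: D_def field_simps)
      show "norm (D n x) \<le> B * indicator (cball 0 (R + 1)) x"
      proof (cases "x \<in> cball 0 (R + 1)")
        case False
        then have x: "norm x > R + 1" by simp
        have "norm x \<le> norm (t n *\<^sub>R e + x) + norm (t n *\<^sub>R e)"
          by (metis add.commute norm_triangle_sub add_diff_cancel_right' norm_minus_commute)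
        then have "norm (t n *\<^sub>R e + x) > R" using x t[of n] ne by simp
        then have "h (t n *\<^sub>R e + x) = 0" "h x = 0"
          using K(2) R x by (metis not_less, metis not_less less_add_one order_trans less_imp_le)
        then show ?thesis using B(1) by (simp add: D_def)
      qed (use * in simp)
    qed
  qed
  then show ?thesis using D0 by (simp add: LIMSEQ_const_iff)
qed

lemma Cc1_product_integrable:
  assumes "open \<Omega>" "\<phi> \<in> Cc1 \<Omega>" "continuous_on UNIV h"
  shows "integrable (lebesgue_on \<Omega>) (\<lambda>x. \<phi> x * h x)"
    "integrable (lebesgue_on \<Omega>) (\<lambda>x. h x * classical_grad \<phi> x $ i)"
proof -
  obtain K where K: "compact K" "K \<subseteq> \<Omega>" "\<And>x. x \<notin> K \<Longrightarrow> \<phi> x = 0" "\<And>x. x \<notin> K \<Longrightarrow> classical_grad \<phi> x = 0"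
    using Cc1_support[OF assms(2)] by blast
  have c: "continuous_on UNIV (\<lambda>x. \<phi> x * h x)" "continuous_on UNIV (\<lambda>x. h x * classical_grad \<phi> x $ i)"
    using Cc1_continuous[OF assms(2)] assms(3) by (auto intro!: continuous_intros)
  show "integrable (lebesgue_on \<Omega>) (\<lambda>x. \<phi> x * h x)"
    using integrable_continuous_compact_support[OF c(1) K(1)] K
    by (subst integral_zero_off_subset(2)[OF assms(1)]) (auto intro: borel_measurable_continuous_onI c)
  show "integrable (lebesgue_on \<Omega>) (\<lambda>x. h x * classical_grad \<phi> x $ i)"
    using integrable_continuous_compact_support[OF c(2) K(1)] K(2,4)
    by (subst integral_zero_off_subset(2)[OF assms(1)])
       (auto intro: borel_measurable_continuous_onI c simp: K(4)[OF contra_subsetD[OF K(2)]])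
qed

lemma has_weak_grad_Cc1:
  assumes "open \<Omega>" "\<phi> \<in> Cc1 \<Omega>"
  shows "has_weak_grad \<Omega> \<phi> (classical_grad \<phi>)"
  unfolding has_weak_grad_def
proof (intro conjI ballI allI)
  fix \<eta> i assume \<eta>: "\<eta> \<in> Cc1 \<Omega>"
  note c = Cc1_continuous[OF assms(2)] Cc1_continuous[OF \<eta>]
  show "integrable (lebesgue_on \<Omega>) (\<lambda>x. \<eta> x * \<phi> x)"
    by (rule Cc1_product_integrable(1)[OF assms(1) \<eta> c(1)])
  show i1: "integrable (lebesgue_on \<Omega>) (\<lambda>x. \<phi> x * classical_grad \<eta> x $ i)"
    by (rule Cc1_product_integrable(2)[OF assms(1) \<eta> c(1)])
  show i2: "integrable (lebesgue_on \<Omega>) (\<lambda>x. classical_grad \<phi> x $ i * \<eta> x)"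
    using Cc1_product_integrable(2)[OF assms c(3)] by (simp add: mult.commute)
  note p = Cc1_mult[OF assms(2) Cc1_C1_with_grad[OF \<eta>]]
  obtain K where K: "K \<subseteq> \<Omega>" "\<And>x. x \<notin> K \<Longrightarrow> classical_grad (\<lambda>x. \<phi> x * \<eta> x) x = 0"
    using Cc1_support[OF p(1)] by blast
  have "0 = (LINT x|lborel. classical_grad (\<lambda>x. \<phi> x * \<eta> x) x $ i)"
    using integral_partial_derivative_Cc1[OF p(1)] by simp
  also have "\<dots> = (LINT x|lebesgue_on \<Omega>. classical_grad (\<lambda>x. \<phi> x * \<eta> x) x $ i)"
  proof (rule integral_zero_off_subset(1)[OF assms(1), symmetric])
    show "classical_grad (\<lambda>x. \<phi> x * \<eta> x) x $ i = 0" if "x \<notin> \<Omega>" for x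
      using K that by (metis subsetD zero_index)
    show "(\<lambda>x. classical_grad (\<lambda>x. \<phi> x * \<eta> x) x $ i) \<in> borel_measurable borel"
      using Cc1_continuous(2)[OF p(1)] by (auto intro!: borel_measurable_continuous_onI continuous_intros)
  qed
  also have "\<dots> = (LINT x|lebesgue_on \<Omega>. classical_grad \<phi> x $ i * \<eta> x) + (LINT x|lebesgue_on \<Omega>. \<phi> x * classical_grad \<eta> x $ i)"
    using i1 i2 by (simp add: p(2) mult.commute[of "\<eta> _"])
  finally show "(LINT x|lebesgue_on \<Omega>. \<phi> x * classical_grad \<eta> x $ i) = - (LINT x|lebesgue_on \<Omega>. classical_grad \<phi> x $ i * \<eta> x)"
    by simp
qed (use Cc1_measurable[OF assms(2)] in auto)

lemma has_weak_grad_diff: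
  assumes "has_weak_grad \<Omega> u g" "has_weak_grad \<Omega> v j"
  shows "has_weak_grad \<Omega> (\<lambda>x. u x - v x) (\<lambda>x. g x - j x)"
proof -
  have m: "u \<in> borel_measurable (lebesgue_on \<Omega>)" "g \<in> borel_measurable (lebesgue_on \<Omega>)"
    "v \<in> borel_measurable (lebesgue_on \<Omega>)" "j \<in> borel_measurable (lebesgue_on \<Omega>)"
    using assms unfolding has_weak_grad_def by auto
  show ?thesis
    unfolding has_weak_grad_def
  proof (intro conjI ballI allI)
    fix \<phi> i assume \<phi>: "\<phi> \<in> Cc1 \<Omega>"
    have a: "integrable (lebesgue_on \<Omega>) (\<lambda>x. \<phi> x * u x)" "integrable (lebesgue_on \<Omega>) (\<lambda>x. \<phi> x * v x)"
      "integrable (lebesgue_on \<Omega>) (\<lambda>x. u x * classical_grad \<phi> x $ i)"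
      "integrable (lebesgue_on \<Omega>) (\<lambda>x. v x * classical_grad \<phi> x $ i)"
      "integrable (lebesgue_on \<Omega>) (\<lambda>x. g x $ i * \<phi> x)"
      "integrable (lebesgue_on \<Omega>) (\<lambda>x. j x $ i * \<phi> x)"
      "(LINT x|lebesgue_on \<Omega>. u x * classical_grad \<phi> x $ i) = - (LINT x|lebesgue_on \<Omega>. g x $ i * \<phi> x)"
      "(LINT x|lebesgue_on \<Omega>. v x * classical_grad \<phi> x $ i) = - (LINT x|lebesgue_on \<Omega>. j x $ i * \<phi> x)"
      using assms \<phi> unfolding has_weak_grad_def by auto
    show "integrable (lebesgue_on \<Omega>) (\<lambda>x. \<phi> x * (u x - v x))"
      "integrable (lebesgue_on \<Omega>) (\<lambda>x. (u x - v x) * classical_grad \<phi> x $ i)"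
      "integrable (lebesgue_on \<Omega>) (\<lambda>x. (g x - j x) $ i * \<phi> x)"
      "(LINT x|lebesgue_on \<Omega>. (u x - v x) * classical_grad \<phi> x $ i) = - (LINT x|lebesgue_on \<Omega>. (g x - j x) $ i * \<phi> x)"
      using a by (simp_all add: left_diff_distrib right_diff_distrib)
  qed (use m in auto)
qed

text \<open>
  For a nonnegative \<open>C\<^sup>1\<close> function \<open>h\<close>, the functions \<open>h / (h + 1/n)\<close> are \<open>C\<^sup>1\<close> with values in \<open>[0, 1]\<close> and
  converge to the indicator function of \<open>{h > 0}\<close>. So \<open>e\<close> has integral 0 over all sets of this form.
  They are closed under intersection, by multiplication, and contain the open half-spaces, hence
  generate the Borel sets; Dynkin's lemma extends the conclusion to all Borel sets.
\<close>

lemma AE_zero_if_orthogonal_to_C1: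
  fixes e :: "real ^ 'n \<Rightarrow> real"
  assumes e: "integrable lborel e"
    and orth: "\<And>h g. C1_with_grad h g \<Longrightarrow> (\<And>x. \<bar>h x\<bar> \<le> 1) \<Longrightarrow> (LINT x|lborel. e x * h x) = 0"
  shows "AE x in lborel. e x = 0"
proof -
  define \<G> :: "(real ^ 'n) set set" where
    "\<G> = {{x. h x > 0} |h. (\<exists>g. C1_with_grad h g) \<and> (\<forall>x. h x \<ge> 0)}"
  have em [measurable]: "e \<in> borel_measurable borel" using e by auto
  have open_G: "open A" if "A \<in> \<G>" for A
  proof -
    obtain h g where "A = {x. h x > 0}" "C1_with_grad h g" using \<open>A \<in> \<G>\<close> by (auto simp: \<G>_def)
    then show ?thesis
      using C1_with_grad_continuous open_Collect_less[of "\<lambda>x. 0" h] by (auto intro: continuous_intros)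
  qed
  have "Int_stable \<G>"
  proof (rule Int_stableI)
    fix A B assume "A \<in> \<G>" "B \<in> \<G>"
    then obtain h g k j where *: "A = {x. h x > 0}" "B = {x. k x > 0}" "C1_with_grad h g" "C1_with_grad k j"
      "\<And>x. h x \<ge> 0" "\<And>x. k x \<ge> 0"
      by (auto simp: \<G>_def)
    have "A \<inter> B = {x. h x * k x > 0}"
      using *(5,6) by (auto simp: *(1,2) zero_less_mult_iff dest: leD)
    then show "A \<inter> B \<in> \<G>"
      using C1_with_grad_mult[OF *(3,4)] *(5,6) by (auto simp: \<G>_def intro!: exI[of _ "\<lambda>x. h x * k x"])
  qed
  have gen: "sigma_sets UNIV \<G> = sets borel"
  proof
    show "sigma_sets UNIV \<G> \<subseteq> sets borel"
      using open_G sets.sigma_sets_subset[of \<G> borel] by (force simp: subset_iff)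
    have "{x::real ^ 'n. x \<bullet> i < a} \<in> \<G>" for i a
    proof -
      have C: "C1_with_grad (\<lambda>x. (max (a + x \<bullet> (- i)) 0)\<^sup>2)
              (\<lambda>x. (2 * max (a + x \<bullet> (- i)) 0) *\<^sub>R (0 + (- i)))"
        by (intro C1_with_grad_square_pos_part C1_with_grad_add C1_with_grad_const C1_with_grad_inner)
      have "{x. x \<bullet> i < a} = {x. (max (a + x \<bullet> (- i)) 0)\<^sup>2 > 0}"
        by (auto simp: max_def)
      then show ?thesis using C unfolding \<G>_def
        by (intro CollectI exI[of _ "\<lambda>x. (max (a + x \<bullet> (- i)) 0)\<^sup>2"] conjI) auto
    qed
    then have "(\<lambda>(a, i). {x::real ^ 'n. x \<bullet> i < a}) ` (UNIV \<times> Basis) \<subseteq> \<G>" by auto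
    then show "sets borel \<subseteq> sigma_sets UNIV \<G>"
      by (subst borel_eq_halfspace_less) (simp add: sigma_sets_mono')
  qed
  have setint: "set_integrable lborel A e" if "A \<in> sets borel" for A
    using e that unfolding set_integrable_def by (intro integrable_mult_indicator) auto
  have basic: "(LINT x:A|lborel. e x) = 0" if A: "A \<in> \<G>" for A
  proof -
    obtain h g where h: "A = {x. h x > 0}" "C1_with_grad h g" "\<And>x. h x \<ge> 0"
      using A by (auto simp: \<G>_def)
    have hm [measurable]: "h \<in> borel_measurable borel"
      using C1_with_grad_continuous[OF h(2)] by (rule borel_measurable_continuous_onI)
    define c where "c n = 1 / real (Suc n)" for n
    have c: "c n > 0" for n by (simp add: c_def)
    have clim: "c \<longlonglongrightarrow> 0" unfolding c_def by (rule LIMSEQ_Suc[OF lim_1_over_n])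
    define H where "H n x = h x * inverse (h x + c n)" for n x
    have pos: "h x + c n > 0" for x n using h(3)[of x] c[of n] by linarith
    have H1: "\<bar>H n x\<bar> \<le> 1" for n x
      using h(3)[of x] c[of n] pos[of x n] by (simp add: H_def field_simps)
    have "(LINT x|lborel. e x * H n x) = 0" for n
    proof (rule orth)
      show "C1_with_grad (H n) (\<lambda>x. inverse (h x + c n) *\<^sub>R g x + h x *\<^sub>R ((- (inverse (h x + c n))\<^sup>2) *\<^sub>R (g x + 0)))"
        unfolding H_def
        by (intro C1_with_grad_mult C1_with_grad_inverse C1_with_grad_add C1_with_grad_const h(2))
           (metis pos less_irrefl)
    qed (rule H1)
    moreover have "(\<lambda>n. LINT x|lborel. e x * H n x) \<longlonglongrightarrow> (LINT x|lborel. indicator A x *\<^sub>R e x)"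
    proof (rule integral_dominated_convergence[where w = "\<lambda>x. \<bar>e x\<bar>"])
      show "(\<lambda>x. indicator A x *\<^sub>R e x) \<in> borel_measurable lborel"
        using open_G[OF A] by auto
      show "(\<lambda>x. e x * H n x) \<in> borel_measurable lborel" for n unfolding H_def by measurable
      show "AE x in lborel. (\<lambda>n. e x * H n x) \<longlonglongrightarrow> indicator A x *\<^sub>R e x"
      proof (rule AE_I2)
        fix x
        show "(\<lambda>n. e x * H n x) \<longlonglongrightarrow> indicator A x *\<^sub>R e x"
        proof (cases "x \<in> A")
          case True
          then have "h x > 0" by (simp add: h(1))
          then have "(\<lambda>n. e x * H n x) \<longlonglongrightarrow> e x * (h x * inverse (h x + 0))"
            unfolding H_def by (intro tendsto_intros clim) auto
          then show ?thesis using True \<open>h x > 0\<close> by simp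
        next
          case False
          then have "h x = 0" using h(3)[of x] by (auto simp: h(1))
          then show ?thesis using False by (simp add: H_def)
        qed
      qed
      show "AE x in lborel. norm (e x * H n x) \<le> \<bar>e x\<bar>" for n
        using H1 by (auto simp: abs_mult intro!: mult_left_le)
    qed (use e in auto)
    ultimately show ?thesis by (simp add: set_lebesgue_integral_def LIMSEQ_const_iff)
  qed
  have UNIV0: "(LINT x|lborel. e x) = 0"
    using orth[OF C1_with_grad_const[of 1]] by simp
  have "(LINT x:A|lborel. e x) = 0" if "A \<in> sets borel" for A
  proof -
    have "\<G> \<subseteq> Pow UNIV" "A \<in> sigma_sets UNIV \<G>" using that gen by simp_all
    with \<open>Int_stable \<G>\<close> show ?thesis
    proof (induction rule: sigma_sets_induct_disjoint)
      case (compl A)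
      have A: "A \<in> sets borel" using compl gen by simp
      have "(LINT x:UNIV - A|lborel. e x) + (LINT x:A|lborel. e x) = (LINT x:(UNIV - A) \<union> A|lborel. e x)"
        using A by (intro set_integral_Un[symmetric] setint) auto
      also have "\<dots> = 0" using UNIV0 by (simp add: set_lebesgue_integral_def)
      finally show ?case using compl by simp
    next
      case (union A)
      have "\<And>i. A i \<in> sets borel" using union gen by auto
      then have "(LINT x:(\<Union>i. A i)|lborel. e x) = (\<Sum>i. (LINT x:(A i)|lborel. e x))"
        using union(1) by (intro lebesgue_integral_countable_add setint) (auto simp: disjoint_family_on_def)
      then show ?case using union by simp
    qed (use basic in \<open>auto simp: set_lebesgue_integral_def\<close>)
  qed
  then show ?thesis
    using e by (intro density_unique_real) (auto simp: set_lebesgue_integral_def)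
qed

lemma Cc1_nonzero_neighbourhood:
  fixes x :: "real ^ 'n"
  assumes "open \<Omega>" "x \<in> \<Omega>"
  shows "\<exists>\<phi>\<in>Cc1 \<Omega>. \<phi> x \<noteq> 0"
proof -
  obtain R where R: "R > 0" "cball x R \<subseteq> \<Omega>" using assms open_contains_cball by blast
  have C: "C1_with_grad (\<lambda>y. (max (R\<^sup>2 + (-1) * ((y - x) \<bullet> (y - x))) 0)\<^sup>2)
     (\<lambda>y. (2 * max (R\<^sup>2 + (-1) * ((y - x) \<bullet> (y - x))) 0) *\<^sub>R
           (0 + (((y - x) \<bullet> (y - x)) *\<^sub>R 0 + (-1) *\<^sub>R (2 *\<^sub>R (y - x)))))"
    by (intro C1_with_grad_square_pos_part C1_with_grad_add C1_with_grad_const C1_with_grad_mult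
        C1_with_grad_dist_square)
  have "(\<lambda>y. (max (R\<^sup>2 + (-1) * ((y - x) \<bullet> (y - x))) 0)\<^sup>2) \<in> Cc1 \<Omega>"
  proof (rule Cc1I(1)[OF C compact_cball R(2)])
    fix y assume "y \<notin> cball x R"
    then have "R < norm (y - x)" by (simp add: dist_norm norm_minus_commute)
    then have "R\<^sup>2 \<le> (norm (y - x))\<^sup>2" using R(1) by (intro power_mono) auto
    then show "(max (R\<^sup>2 + (-1) * ((y - x) \<bullet> (y - x))) 0)\<^sup>2 = 0"
      by (simp add: power2_norm_eq_inner)
  qed
  then show ?thesis using R(1) by (intro bexI) auto
qed

text \<open>
  Multiplying \<open>d\<close> by a test function \<open>\<eta>\<close> gives an integrable function on the whole space that is
  orthogonal to all \<open>C\<^sup>1\<close> functions, hence vanishes almost everywhere; so \<open>d\<close> vanishes a.e. where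
  \<open>\<eta> \<noteq> 0\<close>. Countably many such sets cover \<open>\<Omega>\<close> by the Lindelof property.
\<close>

lemma fundamental_lemma:
  fixes d :: "real ^ 'n \<Rightarrow> real"
  assumes "open \<Omega>" and d: "d \<in> borel_measurable (lebesgue_on \<Omega>)"
    and int: "\<And>\<phi>. \<phi> \<in> Cc1 \<Omega> \<Longrightarrow> integrable (lebesgue_on \<Omega>) (\<lambda>x. d x * \<phi> x)"
    and zero: "\<And>\<phi>. \<phi> \<in> Cc1 \<Omega> \<Longrightarrow> (LINT x|lebesgue_on \<Omega>. d x * \<phi> x) = 0"
  shows "AE x in lebesgue_on \<Omega>. d x = 0"
proof -
  have S: "\<Omega> \<inter> space lebesgue \<in> sets lebesgue" using assms(1) by auto
  have loc: "AE x in lebesgue_on \<Omega>. d x * \<eta> x = 0" if \<eta>: "\<eta> \<in> Cc1 \<Omega>" for \<eta>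
  proof -
    define D where "D x = indicator \<Omega> x *\<^sub>R (d x * \<eta> x)" for x
    have D: "integrable lebesgue D"
      using int[OF \<eta>] unfolding integrable_restrict_space[OF S] by (simp add: D_def[abs_def])
    then have "D \<in> borel_measurable lebesgue" by auto
    \<comment> \<open>A Borel representative is chosen because the orthogonality lemma is about the Borel measure.\<close>
    then obtain e where em: "e \<in> borel_measurable lborel" and "AE x in lborel. D x = e x"
      using completion_ex_borel_measurable_real by blast
    then have De: "AE x in lebesgue. D x = e x" by (simp add: AE_completion)
    have em': "e \<in> borel_measurable lebesgue" using em by (rule measurable_completion)
    have e: "integrable lborel e"
      using D De em em' by (metis integrable_cong_AE_imp integrable_completion)
    have "AE x in lborel. e x = 0"
    proof (rule AE_zero_if_orthogonal_to_C1[OF e])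
      fix h :: "real ^ 'n \<Rightarrow> real" and g assume h: "C1_with_grad h g" "\<And>x. \<bar>h x\<bar> \<le> 1"
      have hm [measurable]: "h \<in> borel_measurable borel"
        using C1_with_grad_continuous[OF h(1)] by (rule borel_measurable_continuous_onI)
      then have hm': "h \<in> borel_measurable lebesgue" by (auto intro: measurable_completion)
      have "(LINT x|lborel. e x * h x) = (LINT x|lebesgue. e x * h x)"
        using em hm by (intro integral_completion[symmetric]) auto
      also have "\<dots> = (LINT x|lebesgue. D x * h x)"
        using De em' hm' D by (intro integral_cong_AE) auto
      also have "\<dots> = (LINT x|lebesgue. indicator \<Omega> x *\<^sub>R (d x * (\<eta> x * h x)))"
        by (simp add: D_def mult.assoc)
      also have "\<dots> = (LINT x|lebesgue_on \<Omega>. d x * (\<eta> x * h x))"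
        by (rule integral_restrict_space[OF S, symmetric])
      also have "\<dots> = 0" by (rule zero[OF Cc1_mult(1)[OF \<eta> h(1)]])
      finally show "(LINT x|lborel. e x * h x) = 0" .
    qed
    then have "AE x in lebesgue. e x = 0" by (rule AE_completion)
    with De have "AE x in lebesgue. D x = 0" by eventually_elim simp
    then show ?thesis
      unfolding AE_restrict_space_iff[OF S] by eventually_elim (auto simp: D_def)
  qed
  define \<F> where "\<F> = (\<lambda>\<phi>. {x. \<phi> x \<noteq> 0}) ` Cc1 \<Omega>"
  have "open U" if "U \<in> \<F>" for U
    using that Cc1_continuous(1)
    by (auto simp: \<F>_def intro!: open_Collect_neq continuous_intros)
  then obtain \<F>' where F': "\<F>' \<subseteq> \<F>" "countable \<F>'" "\<Union>\<F>' = \<Union>\<F>" by (rule Lindelof)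
  have "AE x in lebesgue_on \<Omega>. \<forall>U\<in>\<F>'. x \<in> U \<longrightarrow> d x = 0"
  proof (subst AE_ball_countable[OF F'(2)], rule ballI)
    fix U assume "U \<in> \<F>'"
    then obtain \<phi> where \<phi>: "\<phi> \<in> Cc1 \<Omega>" "U = {x. \<phi> x \<noteq> 0}" using F'(1) by (auto simp: \<F>_def)
    show "AE x in lebesgue_on \<Omega>. x \<in> U \<longrightarrow> d x = 0"
      using loc[OF \<phi>(1)] by eventually_elim (auto simp: \<phi>(2))
  qed
  then show ?thesis
  proof (rule AE_mp, intro AE_I2 impI)
    fix x assume "x \<in> space (lebesgue_on \<Omega>)" and *: "\<forall>U\<in>\<F>'. x \<in> U \<longrightarrow> d x = 0"
    then have "x \<in> \<Omega>" by simp
    then obtain \<phi> where "\<phi> \<in> Cc1 \<Omega>" "\<phi> x \<noteq> 0" using Cc1_nonzero_neighbourhood[OF assms(1)] by blast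
    then have "x \<in> \<Union>\<F>'" unfolding F'(3) by (auto simp: \<F>_def)
    with * show "d x = 0" by blast
  qed
qed

lemma has_weak_grad_unique:
  assumes "open \<Omega>" "has_weak_grad \<Omega> u g" "has_weak_grad \<Omega> u j"
  shows "AE x in lebesgue_on \<Omega>. g x = j x"
proof -
  have m: "g \<in> borel_measurable (lebesgue_on \<Omega>)" "j \<in> borel_measurable (lebesgue_on \<Omega>)"
    using assms unfolding has_weak_grad_def by auto
  have "AE x in lebesgue_on \<Omega>. g x $ i - j x $ i = 0" for i
  proof (rule fundamental_lemma[OF assms(1)])
    show "(\<lambda>x. g x $ i - j x $ i) \<in> borel_measurable (lebesgue_on \<Omega>)"
      using m by (intro borel_measurable_diff borel_measurable_vec_nth_comp) 
    fix \<phi> assume "\<phi> \<in> Cc1 \<Omega>"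
    then have *: "integrable (lebesgue_on \<Omega>) (\<lambda>x. g x $ i * \<phi> x)"
      "integrable (lebesgue_on \<Omega>) (\<lambda>x. j x $ i * \<phi> x)"
      "(LINT x|lebesgue_on \<Omega>. g x $ i * \<phi> x) = (LINT x|lebesgue_on \<Omega>. j x $ i * \<phi> x)"
      using assms(2,3) unfolding has_weak_grad_def by force+
    then show "integrable (lebesgue_on \<Omega>) (\<lambda>x. (g x $ i - j x $ i) * \<phi> x)"
      "(LINT x|lebesgue_on \<Omega>. (g x $ i - j x $ i) * \<phi> x) = 0"
      by (simp_all add: left_diff_distrib)
  qed
  then have "AE x in lebesgue_on \<Omega>. \<forall>i. g x $ i - j x $ i = 0"
    by (simp add: AE_all_countable)
  then show ?thesis by eventually_elim (simp add: vec_eq_iff)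
qed

section \<open>Square integrable vector fields\<close>

definition square_integrable :: "'a measure \<Rightarrow> ('a \<Rightarrow> 'b::euclidean_space) \<Rightarrow> bool" where
  "square_integrable M g \<longleftrightarrow> g \<in> borel_measurable M \<and> integrable M (\<lambda>x. (norm (g x))\<^sup>2)"

lemma square_integrable_norm_bound:
  assumes "square_integrable M g" "h \<in> borel_measurable M"
    and "AE x in M. norm (h x) \<le> C * norm (g x)"
  shows "square_integrable M h"
  unfolding square_integrable_def
proof
  show "integrable M (\<lambda>x. (norm (h x))\<^sup>2)"
  proof (rule Bochner_Integration.integrable_bound)
    show "integrable M (\<lambda>x. C\<^sup>2 * (norm (g x))\<^sup>2)"
      using assms(1) by (simp add: square_integrable_def)
    show "(\<lambda>x. (norm (h x))\<^sup>2) \<in> borel_measurable M" using assms(2) by measurable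
    show "AE x in M. norm ((norm (h x))\<^sup>2) \<le> norm (C\<^sup>2 * (norm (g x))\<^sup>2)"
      using assms(3)
    proof eventually_elim
      case (elim x)
      then have "(norm (h x))\<^sup>2 \<le> (C * norm (g x))\<^sup>2" by (intro power_mono) auto
      then show ?case by (simp add: power_mult_distrib)
    qed
  qed
qed (rule assms(2))

lemma square_integrable_diff:
  assumes "square_integrable M g" "square_integrable M h"
  shows "square_integrable M (\<lambda>x. g x - h x)"
  unfolding square_integrable_def
proof
  have m: "g \<in> borel_measurable M" "h \<in> borel_measurable M"
    using assms by (auto simp: square_integrable_def)
  then show "(\<lambda>x. g x - h x) \<in> borel_measurable M" by simp
  show "integrable M (\<lambda>x. (norm (g x - h x))\<^sup>2)"
  proof (rule Bochner_Integration.integrable_bound)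
    show "integrable M (\<lambda>x. 2 * (norm (g x))\<^sup>2 + 2 * (norm (h x))\<^sup>2)"
      using assms by (simp add: square_integrable_def)
    show "(\<lambda>x. (norm (g x - h x))\<^sup>2) \<in> borel_measurable M" using m by measurable
    have "(norm (g x - h x))\<^sup>2 \<le> 2 * (norm (g x))\<^sup>2 + 2 * (norm (h x))\<^sup>2" for x
    proof -
      have "(norm (g x - h x))\<^sup>2 \<le> (norm (g x) + norm (h x))\<^sup>2"
        by (intro power_mono norm_triangle_ineq4) auto
      also have "\<dots> \<le> 2 * (norm (g x))\<^sup>2 + 2 * (norm (h x))\<^sup>2"
        using zero_le_power2[of "norm (g x) - norm (h x)"] by (simp add: power2_eq_square algebra_simps)
      finally show ?thesis .
    qed
    then show "AE x in M. norm ((norm (g x - h x))\<^sup>2) \<le> norm (2 * (norm (g x))\<^sup>2 + 2 * (norm (h x))\<^sup>2)"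
      by (intro AE_I2) simp
  qed
qed

text \<open>
  The free weight \<open>\<delta>\<close> makes this pointwise inequality a substitute for the integrated Cauchy-Schwarz
  inequality: after integration, \<open>\<delta>\<close> can be matched to the size of the integral of \<open>|b|\<^sup>2\<close>.
\<close>

lemma abs_inner_le_weighted_squares:
  fixes a b :: "'b::real_inner"
  assumes "\<delta> > 0"
  shows "\<bar>a \<bullet> b\<bar> \<le> \<delta> * (norm a)\<^sup>2 + (norm b)\<^sup>2 / \<delta>"
proof -
  have "\<delta> * \<bar>a \<bullet> b\<bar> \<le> \<delta> * (norm a * norm b)"
    using assms by (intro mult_left_mono Cauchy_Schwarz_ineq2) auto
  also have "\<dots> \<le> 2 * (\<delta> * norm a) * norm b"
    using assms by (simp add: mult_nonneg_nonneg)
  also have "\<dots> \<le> (\<delta> * norm a)\<^sup>2 + (norm b)\<^sup>2"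
    by (rule sum_squares_bound)
  also have "\<dots> = \<delta> * (\<delta> * (norm a)\<^sup>2 + (norm b)\<^sup>2 / \<delta>)"
    using assms by (simp add: power2_eq_square algebra_simps)
  finally show ?thesis using assms by (simp only: mult_le_cancel_left_pos)
qed

lemma square_integrable_inner:
  assumes "square_integrable M g" "square_integrable M h"
  shows "integrable M (\<lambda>x. g x \<bullet> h x)"
proof (rule Bochner_Integration.integrable_bound)
  show "integrable M (\<lambda>x. 1 * (norm (g x))\<^sup>2 + (norm (h x))\<^sup>2 / 1)"
    using assms by (simp add: square_integrable_def)
  show "(\<lambda>x. g x \<bullet> h x) \<in> borel_measurable M"
    using assms by (auto simp: square_integrable_def)
  show "AE x in M. norm (g x \<bullet> h x) \<le> norm (1 * (norm (g x))\<^sup>2 + (norm (h x))\<^sup>2 / 1)"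
    using abs_inner_le_weighted_squares[of 1] by (intro AE_I2) simp
qed

text \<open>
  This is how gradients pass to the limit: by the product rule the gradient of a test function is a
  sum of bounded coefficients, which converge a.e., times fields that converge in the mean square. The
  error of the fields is controlled uniformly in the coefficients, the error of the coefficients by
  dominated convergence.
\<close>

lemma tendsto_integral_bounded_times_inner:
  fixes A G :: "'a \<Rightarrow> 'b::euclidean_space" and c :: "nat \<Rightarrow> 'a \<Rightarrow> real"
  assumes A: "square_integrable M A" and G: "square_integrable M G"
    and Gn: "\<And>n. square_integrable M (Gn n)"
    and lim: "(\<lambda>n. LINT x|M. (norm (Gn n x - G x))\<^sup>2) \<longlonglongrightarrow> 0"
    and c: "\<And>n. c n \<in> borel_measurable M" "\<And>n x. \<bar>c n x\<bar> \<le> C"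
    and d: "d \<in> borel_measurable M" "AE x in M. (\<lambda>n. c n x) \<longlonglongrightarrow> d x"
  shows "(\<lambda>n. LINT x|M. c n x * (A x \<bullet> Gn n x)) \<longlonglongrightarrow> (LINT x|M. d x * (A x \<bullet> G x))"
proof -
  define b where "b n = (LINT x|M. (norm (Gn n x - G x))\<^sup>2)" for n
  define a where "a = (LINT x|M. (norm (A x))\<^sup>2)"
  \<comment> \<open>Up to the summand \<open>1 / (n + 1)\<close>, which keeps the weight positive, this is of the size that
    balances the two terms of the weighted inequality.\<close>
  define \<delta> where "\<delta> n = sqrt (b n) + 1 / real (Suc n)" for n
  have C0: "C \<ge> 0" using c(2)[of 0 undefined] by linarith
  have b0: "b n \<ge> 0" for n by (simp add: b_def)
  have \<delta>0: "\<delta> n > 0" for n using b0[of n] by (simp add: \<delta>_def add_nonneg_pos)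
  have D: "square_integrable M (\<lambda>x. Gn n x - G x)" for n
    by (rule square_integrable_diff[OF Gn G])
  have iD: "integrable M (\<lambda>x. c n x * (A x \<bullet> (Gn n x - G x)))" for n
    by (rule integrable_times_bounded(2)[OF square_integrable_inner[OF A D] c(1), where B = C]) (simp add: c(2))
  have iG: "integrable M (\<lambda>x. c n x * (A x \<bullet> G x))" for n
    by (rule integrable_times_bounded(2)[OF square_integrable_inner[OF A G] c(1), where B = C]) (simp add: c(2))
  have small: "(\<lambda>n. LINT x|M. c n x * (A x \<bullet> (Gn n x - G x))) \<longlonglongrightarrow> 0"
  proof (rule Lim_null_comparison)
    show "(\<lambda>n. C * (\<delta> n * a + sqrt (b n))) \<longlonglongrightarrow> 0"
    proof -
      have "b \<longlonglongrightarrow> 0" using lim by (simp add: b_def[abs_def])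
      then have s: "(\<lambda>n. sqrt (b n)) \<longlonglongrightarrow> 0" using tendsto_real_sqrt by fastforce
      have "\<delta> \<longlonglongrightarrow> 0 + 0" unfolding \<delta>_def by (intro tendsto_add s LIMSEQ_Suc[OF lim_1_over_n])
      then have "(\<lambda>n. C * (\<delta> n * a + sqrt (b n))) \<longlonglongrightarrow> C * ((0 + 0) * a + 0)"
        by (intro tendsto_intros s)
      then show ?thesis by simp
    qed
    show "\<forall>\<^sub>F n in sequentially. norm (LINT x|M. c n x * (A x \<bullet> (Gn n x - G x))) \<le> C * (\<delta> n * a + sqrt (b n))"
    proof (rule always_eventually, rule allI)
      fix n
      have i1: "integrable M (\<lambda>x. (norm (A x))\<^sup>2)" "integrable M (\<lambda>x. (norm (Gn n x - G x))\<^sup>2)"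
        using A D by (auto simp: square_integrable_def)
      have "norm (LINT x|M. c n x * (A x \<bullet> (Gn n x - G x))) \<le> (LINT x|M. norm (c n x * (A x \<bullet> (Gn n x - G x))))"
        by (rule integral_norm_bound)
      also have "\<dots> \<le> (LINT x|M. C * (\<delta> n * (norm (A x))\<^sup>2 + (norm (Gn n x - G x))\<^sup>2 / \<delta> n))"
      proof (rule integral_mono[OF integrable_norm[OF iD]])
        show "integrable M (\<lambda>x. C * (\<delta> n * (norm (A x))\<^sup>2 + (norm (Gn n x - G x))\<^sup>2 / \<delta> n))"
          using i1 by simp
        show "norm (c n x * (A x \<bullet> (Gn n x - G x))) \<le> C * (\<delta> n * (norm (A x))\<^sup>2 + (norm (Gn n x - G x))\<^sup>2 / \<delta> n)" for x
          using mult_mono[OF c(2)[of n x] abs_inner_le_weighted_squares[OF \<delta>0[of n], of "A x" "Gn n x - G x"]] C0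
          by (simp add: abs_mult)
      qed
      also have "\<dots> = C * (\<delta> n * a + b n / \<delta> n)" using i1 by (simp add: a_def b_def)
      also have "\<dots> \<le> C * (\<delta> n * a + sqrt (b n))"
      proof -
        have "b n = sqrt (b n) * sqrt (b n)" using b0[of n] by simp
        also have "\<dots> \<le> sqrt (b n) * \<delta> n" using b0[of n] by (intro mult_left_mono) (auto simp: \<delta>_def)
        finally have "b n / \<delta> n \<le> sqrt (b n)" using \<delta>0[of n] by (simp add: divide_le_eq)
        then show ?thesis using C0 by (simp add: mult_left_mono)
      qed
      finally show "norm (LINT x|M. c n x * (A x \<bullet> (Gn n x - G x))) \<le> C * (\<delta> n * a + sqrt (b n))" .
    qed
  qed
  have main: "(\<lambda>n. LINT x|M. c n x * (A x \<bullet> G x)) \<longlonglongrightarrow> (LINT x|M. d x * (A x \<bullet> G x))"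
  proof (rule integral_dominated_convergence[where w = "\<lambda>x. C * \<bar>A x \<bullet> G x\<bar>"])
    have AG: "integrable M (\<lambda>x. A x \<bullet> G x)" by (rule square_integrable_inner[OF A G])
    then show "integrable M (\<lambda>x. C * \<bar>A x \<bullet> G x\<bar>)" by simp
    show "(\<lambda>x. d x * (A x \<bullet> G x)) \<in> borel_measurable M" using AG d(1) by measurable
    show "(\<lambda>x. c n x * (A x \<bullet> G x)) \<in> borel_measurable M" for n using iG by auto
    show "AE x in M. (\<lambda>n. c n x * (A x \<bullet> G x)) \<longlonglongrightarrow> d x * (A x \<bullet> G x)"
      using d(2) by eventually_elim (intro tendsto_intros)
    show "AE x in M. norm (c n x * (A x \<bullet> G x)) \<le> C * \<bar>A x \<bullet> G x\<bar>" for n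
      using c(2) by (intro AE_I2) (simp add: abs_mult mult_right_mono)
  qed
  have "(\<lambda>n. (LINT x|M. c n x * (A x \<bullet> (Gn n x - G x))) + (LINT x|M. c n x * (A x \<bullet> G x)))
      \<longlonglongrightarrow> 0 + (LINT x|M. d x * (A x \<bullet> G x))"
    by (intro tendsto_add small main)
  moreover have "(LINT x|M. c n x * (A x \<bullet> (Gn n x - G x))) + (LINT x|M. c n x * (A x \<bullet> G x))
     = (LINT x|M. c n x * (A x \<bullet> Gn n x))" for n
    unfolding Bochner_Integration.integral_add[OF iD iG, symmetric]
    by (simp add: inner_diff_right algebra_simps)
  ultimately show ?thesis by simp
qed

section \<open>Weak gradients and approximation in the Sobolev space\<close>

lemma L_space_2_iff:
  "f \<in> L_space 2 \<Omega> \<longleftrightarrow> f \<in> borel_measurable (lebesgue_on \<Omega>) \<and> integrable (lebesgue_on \<Omega>) (\<lambda>x. (f x)\<^sup>2)"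
  by (simp add: L_space_def)

lemma square_integrable_componentwise:
  fixes g :: "'a \<Rightarrow> real ^ 'n"
  assumes "g \<in> borel_measurable M" "\<And>i. integrable M (\<lambda>x. (g x $ i)\<^sup>2)"
  shows "square_integrable M g"
proof -
  have "(norm (g x))\<^sup>2 = (\<Sum>i\<in>UNIV. (g x $ i)\<^sup>2)" for x
    unfolding power2_norm_eq_inner inner_vec_def by (simp add: power2_eq_square)
  then show ?thesis using assms by (simp add: square_integrable_def)
qed

lemma Cc1_square_integrable:
  assumes "open \<Omega>" "\<phi> \<in> Cc1 \<Omega>"
  shows "integrable (lebesgue_on \<Omega>) (\<lambda>x. (\<phi> x)\<^sup>2)"
    and "square_integrable (lebesgue_on \<Omega>) (classical_grad \<phi>)"
proof -
  note c = Cc1_continuous[OF assms(2)]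
  show "integrable (lebesgue_on \<Omega>) (\<lambda>x. (\<phi> x)\<^sup>2)"
    using Cc1_product_integrable(1)[OF assms c(1)] by (simp add: power2_eq_square)
  have "integrable (lebesgue_on \<Omega>) (\<lambda>x. classical_grad \<phi> x $ i * classical_grad \<phi> x $ i)" for i
    by (intro Cc1_product_integrable(2)[OF assms] continuous_intros c(2))
  then show "square_integrable (lebesgue_on \<Omega>) (classical_grad \<phi>)"
    by (intro square_integrable_componentwise Cc1_measurable(2)[OF assms(2)]) (simp add: power2_eq_square)
qed

lemma has_weak_grad_weak_grad:
  assumes "has_weak_grad \<Omega> u g"
  shows "has_weak_grad \<Omega> u (weak_grad \<Omega> u)"
  unfolding weak_grad_def by (rule someI[of "has_weak_grad \<Omega> u", OF assms])

lemma weak_grad_AE_eq: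
  assumes "open \<Omega>" "has_weak_grad \<Omega> u g"
  shows "AE x in lebesgue_on \<Omega>. weak_grad \<Omega> u x = g x"
  by (rule has_weak_grad_unique[OF assms(1) has_weak_grad_weak_grad[OF assms(2)] assms(2)])

text \<open>
  The definition of \<open>W12\<close> provides some square integrable weak gradient; by uniqueness the chosen one
  agrees with it almost everywhere.
\<close>

lemma W12_weak_grad:
  assumes "open \<Omega>" "u \<in> W12 \<Omega>"
  shows "has_weak_grad \<Omega> u (weak_grad \<Omega> u)"
    and "square_integrable (lebesgue_on \<Omega>) (weak_grad \<Omega> u)"
proof -
  obtain g where g: "has_weak_grad \<Omega> u g" "\<And>i. (\<lambda>x. g x $ i) \<in> L_space 2 \<Omega>"
    using assms(2) by (auto simp: W12_def)
  show w: "has_weak_grad \<Omega> u (weak_grad \<Omega> u)"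
    using g(1) by (rule has_weak_grad_weak_grad)
  have "g \<in> borel_measurable (lebesgue_on \<Omega>)" using g(1) by (simp add: has_weak_grad_def)
  then have "square_integrable (lebesgue_on \<Omega>) g"
    using g(2) unfolding L_space_2_iff by (intro square_integrable_componentwise) auto
  then show "square_integrable (lebesgue_on \<Omega>) (weak_grad \<Omega> u)"
  proof (rule square_integrable_norm_bound[where C = 1])
    show "weak_grad \<Omega> u \<in> borel_measurable (lebesgue_on \<Omega>)"
      using w by (simp add: has_weak_grad_def)
    show "AE x in lebesgue_on \<Omega>. norm (weak_grad \<Omega> u x) \<le> 1 * norm (g x)"
      using weak_grad_AE_eq[OF assms(1) g(1)] by eventually_elim simp
  qed
qed

lemma W012_weak_grad:
  assumes "open \<Omega>" "v \<in> W012 \<Omega>"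
  shows "v \<in> borel_measurable (lebesgue_on \<Omega>)"
    and "square_integrable (lebesgue_on \<Omega>) (weak_grad \<Omega> v)"
proof -
  have "v \<in> W12 \<Omega>" using assms(2) by (simp add: W012_def)
  from W12_weak_grad[OF assms(1) this]
  show "v \<in> borel_measurable (lebesgue_on \<Omega>)" "square_integrable (lebesgue_on \<Omega>) (weak_grad \<Omega> v)"
    by (auto simp: has_weak_grad_def)
qed

text \<open>
  The norm in the definition of \<open>W012\<close> involves the chosen weak gradient of the difference
  \<open>\<phi> - v\<close>; by uniqueness this is the classical gradient of \<open>\<phi>\<close> minus the chosen weak gradient of \<open>v\<close>.
  Passing to a subsequence turns convergence in the mean square into convergence almost everywhere.
\<close>

lemma W012_approximation:
  assumes "open \<Omega>" "v \<in> W012 \<Omega>"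
  shows "\<exists>\<phi>::nat \<Rightarrow> _. (\<forall>k. \<phi> k \<in> Cc1 \<Omega>) \<and> (AE x in lebesgue_on \<Omega>. (\<lambda>k. \<phi> k x) \<longlonglongrightarrow> v x) \<and>
    (\<lambda>k. LINT x|lebesgue_on \<Omega>. (norm (classical_grad (\<phi> k) x - weak_grad \<Omega> v x))\<^sup>2) \<longlonglongrightarrow> 0"
proof -
  let ?M = "lebesgue_on \<Omega>"
  have v: "v \<in> W12 \<Omega>" using assms(2) by (simp add: W012_def)
  have vm: "v \<in> borel_measurable ?M" "integrable ?M (\<lambda>x. (v x)\<^sup>2)"
    using v unfolding W12_def L_space_2_iff by auto
  note vg = W12_weak_grad[OF assms(1) v]
  have "\<forall>k. \<exists>\<phi>\<in>Cc1 \<Omega>. W12_norm \<Omega> (\<lambda>x. \<phi> x - v x) < 1 / real (Suc k)"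
    using assms(2) by (auto simp: W012_def)
  then obtain \<phi> where \<phi>: "\<And>k. \<phi> k \<in> Cc1 \<Omega>" "\<And>k. W12_norm \<Omega> (\<lambda>x. \<phi> k x - v x) < 1 / real (Suc k)"
    by metis
  define p where "p k = (LINT x|?M. (\<phi> k x - v x)\<^sup>2)" for k
  define q where "q k = (LINT x|?M. (norm (classical_grad (\<phi> k) x - weak_grad \<Omega> v x))\<^sup>2)" for k
  have pq0: "p k \<ge> 0" "q k \<ge> 0" for k by (auto simp: p_def q_def)
  have "W12_norm \<Omega> (\<lambda>x. \<phi> k x - v x) = sqrt (p k + q k)" for k
  proof -
    have hw: "has_weak_grad \<Omega> (\<lambda>x. \<phi> k x - v x) (\<lambda>x. classical_grad (\<phi> k) x - weak_grad \<Omega> v x)"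
      by (rule has_weak_grad_diff[OF has_weak_grad_Cc1[OF assms(1) \<phi>(1)] vg(1)])
    have "has_weak_grad \<Omega> (\<lambda>x. \<phi> k x - v x) (weak_grad \<Omega> (\<lambda>x. \<phi> k x - v x))"
      using hw by (rule has_weak_grad_weak_grad)
    then have m: "weak_grad \<Omega> (\<lambda>x. \<phi> k x - v x) \<in> borel_measurable ?M"
      "(\<lambda>x. classical_grad (\<phi> k) x - weak_grad \<Omega> v x) \<in> borel_measurable ?M"
      using hw by (auto simp: has_weak_grad_def)
    have "(LINT x|?M. (norm (weak_grad \<Omega> (\<lambda>x. \<phi> k x - v x) x))\<^sup>2) = q k"
      unfolding q_def
    proof (rule integral_cong_AE)
      show "AE x in ?M. (norm (weak_grad \<Omega> (\<lambda>x. \<phi> k x - v x) x))\<^sup>2 = (norm (classical_grad (\<phi> k) x - weak_grad \<Omega> v x))\<^sup>2"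
        using weak_grad_AE_eq[OF assms(1) hw] by eventually_elim simp
    qed (use m in measurable)
    then show ?thesis by (simp add: W12_norm_def p_def)
  qed
  then have "sqrt (p k + q k) \<le> 1 / real (Suc k)" for k using \<phi>(2)[of k] by simp
  then have s: "(\<lambda>k. sqrt (p k + q k)) \<longlonglongrightarrow> 0"
    by (intro tendsto_sandwich[OF _ _ tendsto_const LIMSEQ_Suc[OF lim_1_over_n]])
       (auto simp: pq0 intro!: always_eventually add_nonneg_nonneg)
  have "(\<lambda>k. (sqrt (p k + q k))\<^sup>2) \<longlonglongrightarrow> 0\<^sup>2" by (intro tendsto_power s)
  then have pq: "(\<lambda>k. p k + q k) \<longlonglongrightarrow> 0" by (simp add: pq0 add_nonneg_nonneg)
  have p: "p \<longlonglongrightarrow> 0" and q: "q \<longlonglongrightarrow> 0"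
    using pq0 by (auto intro!: tendsto_sandwich[OF _ _ tendsto_const pq] always_eventually)
  have i: "integrable ?M (\<lambda>x. (\<phi> k x - v x)\<^sup>2)" for k
  proof -
    have "square_integrable ?M (\<lambda>x. \<phi> k x - v x)"
      using vm Cc1_square_integrable(1)[OF assms(1) \<phi>(1)] Cc1_measurable(1)[OF \<phi>(1)]
      by (intro square_integrable_diff) (auto simp: square_integrable_def)
    then show ?thesis by (simp add: square_integrable_def)
  qed
  have "\<exists>r::nat \<Rightarrow> nat. strict_mono r \<and> (AE x in ?M. (\<lambda>n. (\<phi> (r n) x - v x)\<^sup>2) \<longlonglongrightarrow> 0)"
    using p by (intro tendsto_L1_AE_subseq i) (simp add: p_def[abs_def])
  then obtain r :: "nat \<Rightarrow> nat" where r: "strict_mono r" "AE x in ?M. (\<lambda>n. (\<phi> (r n) x - v x)\<^sup>2) \<longlonglongrightarrow> 0"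
    by blast
  show ?thesis
  proof (intro exI[of _ "\<lambda>n. \<phi> (r n)"] conjI allI \<phi>(1))
    show "AE x in ?M. (\<lambda>n. \<phi> (r n) x) \<longlonglongrightarrow> v x"
      using r(2)
    proof eventually_elim
      case (elim x)
      then have "(\<lambda>n. sqrt ((\<phi> (r n) x - v x)\<^sup>2)) \<longlonglongrightarrow> sqrt 0" by (intro tendsto_real_sqrt)
      then have "(\<lambda>n. \<phi> (r n) x - v x) \<longlonglongrightarrow> 0" by (simp add: tendsto_rabs_zero_iff)
      then show ?case by (simp add: LIM_zero_iff)
    qed
    show "(\<lambda>n. LINT x|?M. (norm (classical_grad (\<phi> (r n)) x - weak_grad \<Omega> v x))\<^sup>2) \<longlonglongrightarrow> 0"
      using LIMSEQ_subseq_LIMSEQ[OF q r(1)] by (simp add: q_def o_def)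
  qed
qed

section \<open>A smooth minimum of positive parts\<close>

text \<open>
  A \<open>C\<^sup>1\<close> approximation of the positive part from below, exactly 0 for \<open>s \<le> 0\<close>. The latter makes the
  coefficients of the gradients vanish on the set where the limit function is not positive, including
  its zero set.
\<close>

definition smooth_pos :: "real \<Rightarrow> real \<Rightarrow> real" where
  "smooth_pos \<epsilon> s = sqrt ((max s 0)\<^sup>2 + \<epsilon>\<^sup>2) - \<epsilon>"

definition smooth_pos_deriv :: "real \<Rightarrow> real \<Rightarrow> real" where
  "smooth_pos_deriv \<epsilon> s = max s 0 / sqrt ((max s 0)\<^sup>2 + \<epsilon>\<^sup>2)"

text \<open>
  With \<open>p\<close> and \<open>q\<close> the smooth positive parts of \<open>s\<close> and \<open>t\<close>, this is \<open>2 p q / (p + q + \<epsilon>)\<close>: the harmonic mean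
  of \<open>p\<close> and \<open>q\<close>, kept smooth at the origin by \<open>\<epsilon>\<close>. It is at most twice the minimum of \<open>p\<close> and \<open>q\<close>, and
  for \<open>s = t > 0\<close> it tends to \<open>s\<close> as \<open>\<epsilon>\<close> tends to 0.
\<close>

definition smooth_min :: "real \<Rightarrow> real \<Rightarrow> real \<Rightarrow> real" where
  "smooth_min \<epsilon> s t = 2 * smooth_pos \<epsilon> s * smooth_pos \<epsilon> t * inverse (smooth_pos \<epsilon> s + smooth_pos \<epsilon> t + \<epsilon>)"

text \<open>
  The partial derivative of \<open>smooth_min \<epsilon> s t\<close> in \<open>s\<close>; by symmetry the one in \<open>t\<close> is
  \<open>smooth_min_deriv \<epsilon> t s\<close>.
\<close>

definition smooth_min_deriv :: "real \<Rightarrow> real \<Rightarrow> real \<Rightarrow> real" where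
  "smooth_min_deriv \<epsilon> s t = 2 * smooth_pos \<epsilon> t * (smooth_pos \<epsilon> t + \<epsilon>) *
     (inverse (smooth_pos \<epsilon> s + smooth_pos \<epsilon> t + \<epsilon>))\<^sup>2 * smooth_pos_deriv \<epsilon> s"

lemma smooth_pos_bounds:
  assumes "\<epsilon> > 0"
  shows "0 \<le> smooth_pos \<epsilon> s" "smooth_pos \<epsilon> s \<le> max s 0"
    "0 \<le> smooth_pos_deriv \<epsilon> s" "smooth_pos_deriv \<epsilon> s \<le> 1"
proof -
  have r: "\<epsilon> \<le> sqrt ((max s 0)\<^sup>2 + \<epsilon>\<^sup>2)" "max s 0 \<le> sqrt ((max s 0)\<^sup>2 + \<epsilon>\<^sup>2)"
    by (auto intro!: real_le_rsqrt)
  have p: "sqrt ((max s 0)\<^sup>2 + \<epsilon>\<^sup>2) > 0" using assms r(1) by linarith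
  show "0 \<le> smooth_pos \<epsilon> s" using r by (simp add: smooth_pos_def)
  show "smooth_pos \<epsilon> s \<le> max s 0"
    using sqrt_sum_squares_le_sum[of "max s 0" \<epsilon>] assms by (simp add: smooth_pos_def)
  show "0 \<le> smooth_pos_deriv \<epsilon> s" using p by (simp add: smooth_pos_deriv_def)
  show "smooth_pos_deriv \<epsilon> s \<le> 1" using p r(2) by (simp only: smooth_pos_deriv_def divide_le_eq_1_pos)
qed

lemma smooth_pos_nonpos:
  assumes "\<epsilon> > 0" "s \<le> 0"
  shows "smooth_pos \<epsilon> s = 0" "smooth_pos_deriv \<epsilon> s = 0"
  using assms by (auto simp: smooth_pos_def smooth_pos_deriv_def max_def)

lemma smooth_min_commute: "smooth_min \<epsilon> s t = smooth_min \<epsilon> t s"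
  by (simp add: smooth_min_def add.commute)

lemma smooth_min_bounds:
  assumes "\<epsilon> > 0"
  shows "0 \<le> smooth_min \<epsilon> s t" "smooth_min \<epsilon> s t \<le> 2 * max s 0" "smooth_min \<epsilon> s t \<le> 2 * max t 0"
    "\<bar>smooth_min_deriv \<epsilon> s t\<bar> \<le> 2"
proof -
  note b = smooth_pos_bounds[OF assms]
  have le: "smooth_min \<epsilon> s t \<le> 2 * max s 0" for s t
  proof -
    have "smooth_min \<epsilon> s t = 2 * smooth_pos \<epsilon> s * (smooth_pos \<epsilon> t / (smooth_pos \<epsilon> s + smooth_pos \<epsilon> t + \<epsilon>))"
      by (simp add: smooth_min_def divide_inverse)
    also have "\<dots> \<le> 2 * smooth_pos \<epsilon> s * 1"
      using b(1)[of s] b(1)[of t] assms by (intro mult_left_mono) auto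
    finally show ?thesis using b(2)[of s] by simp
  qed
  show "smooth_min \<epsilon> s t \<le> 2 * max s 0" by (rule le)
  show "smooth_min \<epsilon> s t \<le> 2 * max t 0" using le[of t s] by (simp add: smooth_min_commute)
  show "0 \<le> smooth_min \<epsilon> s t"
    using b(1)[of s] b(1)[of t] assms by (simp add: smooth_min_def)
  define p where "p = smooth_pos \<epsilon> s"
  define q where "q = smooth_pos \<epsilon> t"
  have pq: "p \<ge> 0" "q \<ge> 0" using b by (auto simp: p_def q_def)
  have "2 * q * (q + \<epsilon>) * (inverse (p + q + \<epsilon>))\<^sup>2 = 2 * (q / (p + q + \<epsilon>)) * ((q + \<epsilon>) / (p + q + \<epsilon>))"
    by (simp add: divide_inverse power2_eq_square)
  also have "\<dots> \<le> 2 * 1 * 1" using pq assms by (intro mult_mono) auto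
  finally have "2 * q * (q + \<epsilon>) * (inverse (p + q + \<epsilon>))\<^sup>2 * smooth_pos_deriv \<epsilon> s \<le> 2 * 1"
    using b(3,4)[of s] by (intro mult_mono) auto
  moreover have "2 * q * (q + \<epsilon>) * (inverse (p + q + \<epsilon>))\<^sup>2 * smooth_pos_deriv \<epsilon> s \<ge> 0"
    using pq assms b(3)[of s] by (intro mult_nonneg_nonneg) auto
  ultimately show "\<bar>smooth_min_deriv \<epsilon> s t\<bar> \<le> 2"
    by (simp add: smooth_min_deriv_def p_def q_def)
qed

lemma smooth_min_measurable [measurable]:
  assumes [measurable]: "s \<in> borel_measurable M" "t \<in> borel_measurable M"
  shows "(\<lambda>x. smooth_min \<epsilon> (s x) (t x)) \<in> borel_measurable M"
    "(\<lambda>x. smooth_min_deriv \<epsilon> (s x) (t x)) \<in> borel_measurable M"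
  unfolding smooth_min_def smooth_min_deriv_def smooth_pos_def smooth_pos_deriv_def by measurable

lemma tendsto_smooth_pos:
  assumes "(s \<longlongrightarrow> s0) F"
  shows "((\<lambda>x. smooth_pos \<epsilon> (s x)) \<longlongrightarrow> smooth_pos \<epsilon> s0) F"
    "\<epsilon> > 0 \<Longrightarrow> ((\<lambda>x. smooth_pos_deriv \<epsilon> (s x)) \<longlongrightarrow> smooth_pos_deriv \<epsilon> s0) F"
  unfolding smooth_pos_def smooth_pos_deriv_def
  using assms by (auto intro!: tendsto_intros simp: sum_power2_eq_zero_iff)

lemma tendsto_smooth_min:
  assumes "\<epsilon> > 0" "(s \<longlongrightarrow> s0) F" "(t \<longlongrightarrow> t0) F"
  shows "((\<lambda>x. smooth_min \<epsilon> (s x) (t x)) \<longlongrightarrow> smooth_min \<epsilon> s0 t0) F"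
    "((\<lambda>x. smooth_min_deriv \<epsilon> (s x) (t x)) \<longlongrightarrow> smooth_min_deriv \<epsilon> s0 t0) F"
proof -
  have "smooth_pos \<epsilon> s0 + smooth_pos \<epsilon> t0 + \<epsilon> > 0"
    using smooth_pos_bounds(1)[OF assms(1), of s0] smooth_pos_bounds(1)[OF assms(1), of t0] assms(1) by linarith
  then have n: "smooth_pos \<epsilon> s0 + smooth_pos \<epsilon> t0 + \<epsilon> \<noteq> 0" by simp
  note p = tendsto_smooth_pos(1)[OF assms(2)] tendsto_smooth_pos(1)[OF assms(3)]
    tendsto_smooth_pos(2)[OF assms(2,1)]
  show "((\<lambda>x. smooth_min \<epsilon> (s x) (t x)) \<longlongrightarrow> smooth_min \<epsilon> s0 t0) F"
    unfolding smooth_min_def by (intro tendsto_mult tendsto_add tendsto_inverse tendsto_const p n)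
  show "((\<lambda>x. smooth_min_deriv \<epsilon> (s x) (t x)) \<longlongrightarrow> smooth_min_deriv \<epsilon> s0 t0) F"
    unfolding smooth_min_deriv_def
    by (intro tendsto_mult tendsto_add tendsto_inverse tendsto_power tendsto_const p n)
qed

lemma DERIV_smooth_pos:
  assumes "\<epsilon> > 0"
  shows "(smooth_pos \<epsilon> has_field_derivative smooth_pos_deriv \<epsilon> s) (at s)"
proof -
  have p: "(max s 0)\<^sup>2 + \<epsilon>\<^sup>2 > 0" using assms by (simp add: add_nonneg_pos)
  have "((\<lambda>s. (max s 0)\<^sup>2 + \<epsilon>\<^sup>2) has_field_derivative 2 * max s 0) (at s)"
    using DERIV_add[OF DERIV_square_pos_part[of s] DERIV_const[of "\<epsilon>\<^sup>2"]] by simp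
  note d = DERIV_chain2[OF DERIV_real_sqrt[OF p] this]
  have e: "inverse S / 2 * (2 * m) = m / S" for S m :: real by (cases "S = 0") (simp_all add: field_simps)
  from d
  have "((\<lambda>s. sqrt ((max s 0)\<^sup>2 + \<epsilon>\<^sup>2)) has_field_derivative smooth_pos_deriv \<epsilon> s) (at s)"
    unfolding smooth_pos_deriv_def by (rule DERIV_cong) (simp only: e)
  from DERIV_diff[OF this DERIV_const[of \<epsilon>]] show ?thesis
    by (simp add: smooth_pos_def[abs_def])
qed

lemma smooth_min_Cc1:
  assumes "\<epsilon> > 0" "\<phi> \<in> Cc1 \<Omega>" "\<eta> \<in> Cc1 \<Omega>"
  shows "(\<lambda>x. smooth_min \<epsilon> (\<phi> x) (\<eta> x)) \<in> Cc1 \<Omega>"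
    and "classical_grad (\<lambda>x. smooth_min \<epsilon> (\<phi> x) (\<eta> x)) =
      (\<lambda>x. smooth_min_deriv \<epsilon> (\<phi> x) (\<eta> x) *\<^sub>R classical_grad \<phi> x
         + smooth_min_deriv \<epsilon> (\<eta> x) (\<phi> x) *\<^sub>R classical_grad \<eta> x)"
proof -
  let ?P = "smooth_pos \<epsilon>" and ?D = "smooth_pos_deriv \<epsilon>"
  note b = smooth_pos_bounds[OF assms(1)]
  have contD: "continuous_on S ?D" for S
    unfolding continuous_on_def using tendsto_smooth_pos(2)[OF _ assms(1)] by (auto intro: tendsto_ident_at)
  have P: "C1_with_grad (\<lambda>x. ?P (\<phi> x)) (\<lambda>x. ?D (\<phi> x) *\<^sub>R classical_grad \<phi> x)" if "\<phi> \<in> Cc1 \<Omega>" for \<phi>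
    by (rule C1_with_grad_compose[OF Cc1_C1_with_grad[OF that] DERIV_smooth_pos[OF assms(1)] contD])
  define d where "d x = ?P (\<phi> x) + ?P (\<eta> x) + \<epsilon>" for x
  have d: "d x \<noteq> 0" for x using b(1)[of "\<phi> x"] b(1)[of "\<eta> x"] assms(1) by (simp add: d_def)
  let ?g = "\<lambda>x. inverse (d x) *\<^sub>R (?P (\<eta> x) *\<^sub>R (?P (\<phi> x) *\<^sub>R 0 + 2 *\<^sub>R ?D (\<phi> x) *\<^sub>R classical_grad \<phi> x)
        + (2 * ?P (\<phi> x)) *\<^sub>R ?D (\<eta> x) *\<^sub>R classical_grad \<eta> x)
      + (2 * ?P (\<phi> x) * ?P (\<eta> x)) *\<^sub>R (- (inverse (d x))\<^sup>2) *\<^sub>R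
          (?D (\<phi> x) *\<^sub>R classical_grad \<phi> x + ?D (\<eta> x) *\<^sub>R classical_grad \<eta> x + 0)"
  have C: "C1_with_grad (\<lambda>x. smooth_min \<epsilon> (\<phi> x) (\<eta> x)) ?g"
    unfolding smooth_min_def d_def
    by (intro C1_with_grad_mult C1_with_grad_inverse C1_with_grad_add C1_with_grad_const P assms)
       (use d in \<open>simp add: d_def\<close>)
  have g: "?g x = smooth_min_deriv \<epsilon> (\<phi> x) (\<eta> x) *\<^sub>R classical_grad \<phi> x
         + smooth_min_deriv \<epsilon> (\<eta> x) (\<phi> x) *\<^sub>R classical_grad \<eta> x" for x
  proof -
    define p where "p = ?P (\<phi> x)"
    define q where "q = ?P (\<eta> x)"
    define i where "i = inverse (d x)"
    have i: "i * (p + q + \<epsilon>) = 1" using d[of x] by (simp add: i_def p_def q_def d_def)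
    have e1: "2 * q * i - 2 * p * q * i\<^sup>2 = 2 * q * (q + \<epsilon>) * i\<^sup>2"
    proof -
      have "2 * q * i = 2 * q * i * (i * (p + q + \<epsilon>))" using i by simp
      then show ?thesis by (simp add: power2_eq_square algebra_simps)
    qed
    have e2: "2 * p * i - 2 * p * q * i\<^sup>2 = 2 * p * (p + \<epsilon>) * i\<^sup>2"
    proof -
      have "2 * p * i = 2 * p * i * (i * (p + q + \<epsilon>))" using i by simp
      then show ?thesis by (simp add: power2_eq_square algebra_simps)
    qed
    have s: "smooth_min_deriv \<epsilon> (\<phi> x) (\<eta> x) = (2 * q * i - 2 * p * q * i\<^sup>2) * ?D (\<phi> x)"
      "smooth_min_deriv \<epsilon> (\<eta> x) (\<phi> x) = (2 * p * i - 2 * p * q * i\<^sup>2) * ?D (\<eta> x)"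
      unfolding e1 e2 by (simp_all add: smooth_min_deriv_def p_def q_def i_def d_def add.commute)
    show ?thesis unfolding s p_def[symmetric] q_def[symmetric] i_def[symmetric]
      by (simp add: algebra_simps scaleR_left_diff_distrib)
  qed
  obtain K where K: "compact K" "K \<subseteq> \<Omega>" "\<And>x. x \<notin> K \<Longrightarrow> \<phi> x = 0"
    using Cc1_support[OF assms(2)] by blast
  have z: "smooth_min \<epsilon> (\<phi> x) (\<eta> x) = 0" if "x \<notin> K" for x
    using K(3)[OF that] smooth_pos_nonpos[OF assms(1), of 0] by (simp add: smooth_min_def)
  show "(\<lambda>x. smooth_min \<epsilon> (\<phi> x) (\<eta> x)) \<in> Cc1 \<Omega>"
    using Cc1I(1)[OF C K(1,2)] z by blast
  show "classical_grad (\<lambda>x. smooth_min \<epsilon> (\<phi> x) (\<eta> x)) =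
      (\<lambda>x. smooth_min_deriv \<epsilon> (\<phi> x) (\<eta> x) *\<^sub>R classical_grad \<phi> x
         + smooth_min_deriv \<epsilon> (\<eta> x) (\<phi> x) *\<^sub>R classical_grad \<eta> x)"
    unfolding C1_with_grad_unique[OF C] using g by (rule ext)
qed

lemma smooth_pos_limit:
  assumes "\<epsilon> \<longlonglongrightarrow> 0" "t \<longlonglongrightarrow> t0"
  shows "(\<lambda>k. smooth_pos (\<epsilon> k) (t k)) \<longlonglongrightarrow> max t0 0"
    "t0 > 0 \<Longrightarrow> (\<lambda>k. smooth_pos_deriv (\<epsilon> k) (t k)) \<longlonglongrightarrow> 1"
proof -
  have "(\<lambda>k. smooth_pos (\<epsilon> k) (t k)) \<longlonglongrightarrow> sqrt ((max t0 0)\<^sup>2 + 0\<^sup>2) - 0"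
    unfolding smooth_pos_def by (intro tendsto_intros assms)
  then show "(\<lambda>k. smooth_pos (\<epsilon> k) (t k)) \<longlonglongrightarrow> max t0 0" by simp
  assume "t0 > 0"
  then have "(\<lambda>k. smooth_pos_deriv (\<epsilon> k) (t k)) \<longlonglongrightarrow> max t0 0 / sqrt ((max t0 0)\<^sup>2 + 0\<^sup>2)"
    unfolding smooth_pos_deriv_def by (intro tendsto_intros assms) (simp add: max_def)
  then show "(\<lambda>k. smooth_pos_deriv (\<epsilon> k) (t k)) \<longlonglongrightarrow> 1" using \<open>t0 > 0\<close> by (simp add: max_def)
qed

text \<open>
  Near the diagonal the two partial derivatives tend to one half each if \<open>t0 > 0\<close>, so that together
  they reproduce the gradient. If \<open>t0 \<le> 0\<close> they are 0 for every \<open>\<epsilon>\<close>: the first one contains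
  the smooth positive part of \<open>t0\<close> as a factor, the second one its derivative.
\<close>

lemma smooth_min_limit:
  assumes "\<And>k. \<epsilon> k > 0" "\<epsilon> \<longlonglongrightarrow> 0" "t \<longlonglongrightarrow> t0"
  shows "(\<lambda>k. smooth_min (\<epsilon> k) (t k) t0) \<longlonglongrightarrow> max t0 0"
    "(\<lambda>k. smooth_min_deriv (\<epsilon> k) (t k) t0) \<longlonglongrightarrow> (if t0 > 0 then 1 / 2 else 0)"
    "(\<lambda>k. smooth_min_deriv (\<epsilon> k) t0 (t k)) \<longlonglongrightarrow> (if t0 > 0 then 1 / 2 else 0)"
proof -
  have "(\<lambda>k. smooth_min (\<epsilon> k) (t k) t0) \<longlonglongrightarrow> max t0 0 \<and>
    (\<lambda>k. smooth_min_deriv (\<epsilon> k) (t k) t0) \<longlonglongrightarrow> (if t0 > 0 then 1 / 2 else 0) \<and>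
    (\<lambda>k. smooth_min_deriv (\<epsilon> k) t0 (t k)) \<longlonglongrightarrow> (if t0 > 0 then 1 / 2 else 0)"
  proof (cases "t0 > 0")
    case True
    note p = smooth_pos_limit[OF assms(2,3)] smooth_pos_limit[OF assms(2) tendsto_const[of t0]]
    have m: "max t0 0 = t0" using True by simp
    have l1: "(\<lambda>k. smooth_min (\<epsilon> k) (t k) t0) \<longlonglongrightarrow> 2 * t0 * t0 * inverse (t0 + t0 + 0)"
      unfolding smooth_min_def using True p by (intro tendsto_intros assms(2)) (simp_all add: m)
    have l2: "(\<lambda>k. smooth_min_deriv (\<epsilon> k) (t k) t0) \<longlonglongrightarrow> 2 * t0 * (t0 + 0) * (inverse (t0 + t0 + 0))\<^sup>2 * 1"
      unfolding smooth_min_deriv_def using True p by (intro tendsto_intros assms(2)) (simp_all add: m)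
    have l3: "(\<lambda>k. smooth_min_deriv (\<epsilon> k) t0 (t k)) \<longlonglongrightarrow> 2 * t0 * (t0 + 0) * (inverse (t0 + t0 + 0))\<^sup>2 * 1"
      unfolding smooth_min_deriv_def using True p by (intro tendsto_intros assms(2)) (simp_all add: m)
    have e: "2 * t0 * t0 * inverse (t0 + t0 + 0) = t0" "2 * t0 * (t0 + 0) * (inverse (t0 + t0 + 0))\<^sup>2 * 1 = 1 / 2"
      using True by (simp_all add: field_simps power2_eq_square)
    show ?thesis using l1 l2 l3 unfolding e using True by simp
  next
    case False
    then have "t0 \<le> 0" by simp
    then show ?thesis
      using smooth_pos_nonpos[OF assms(1)] by (simp add: smooth_min_def smooth_min_deriv_def)
  qed
  then show "(\<lambda>k. smooth_min (\<epsilon> k) (t k) t0) \<longlonglongrightarrow> max t0 0"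
    "(\<lambda>k. smooth_min_deriv (\<epsilon> k) (t k) t0) \<longlonglongrightarrow> (if t0 > 0 then 1 / 2 else 0)"
    "(\<lambda>k. smooth_min_deriv (\<epsilon> k) t0 (t k)) \<longlonglongrightarrow> (if t0 > 0 then 1 / 2 else 0)" by auto
qed

section \<open>Testing with Sobolev functions\<close>

text \<open>
  Fatou's lemma for real functions, in the form that yields integrability of a pointwise limit.
\<close>

lemma integrable_limit_of_bounded_integrals:
  fixes h :: "nat \<Rightarrow> 'a \<Rightarrow> real"
  assumes h: "\<And>k. integrable M (h k)" "\<And>k. AE x in M. 0 \<le> h k x"
    and lim: "AE x in M. (\<lambda>k. h k x) \<longlonglongrightarrow> g x" "(\<lambda>k. LINT x|M. h k x) \<longlonglongrightarrow> L"
    and g: "g \<in> borel_measurable M"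
  shows "integrable M g"
proof (rule integrableI_bounded[OF g])
  have "AE x in M. \<forall>k. 0 \<le> h k x" using h(2) by (simp add: AE_all_countable)
  with lim(1) have "AE x in M. ennreal (norm (g x)) = liminf (\<lambda>k. ennreal (h k x))"
  proof eventually_elim
    case (elim x)
    then have "0 \<le> g x" by (intro LIMSEQ_le_const[OF elim(1)]) auto
    moreover have "(\<lambda>k. ennreal (h k x)) \<longlonglongrightarrow> ennreal (g x)" using elim by (intro tendsto_ennrealI)
    ultimately show ?case using lim_imp_Liminf[OF sequentially_bot] by fastforce
  qed
  then have "(\<integral>\<^sup>+ x. ennreal (norm (g x)) \<partial>M) = (\<integral>\<^sup>+ x. liminf (\<lambda>k. ennreal (h k x)) \<partial>M)"
    by (rule nn_integral_cong_AE)
  also have "\<dots> \<le> liminf (\<lambda>k. \<integral>\<^sup>+ x. ennreal (h k x) \<partial>M)"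
    using borel_measurable_integrable[OF h(1)] by (intro nn_integral_liminf) measurable
  also have "\<dots> = liminf (\<lambda>k. ennreal (LINT x|M. h k x))"
    by (simp add: nn_integral_eq_integral[OF h])
  also have "\<dots> = ennreal L"
    using lim(2) by (intro lim_imp_Liminf tendsto_ennrealI) auto
  also have "\<dots> < \<infinity>" by simp
  finally show "(\<integral>\<^sup>+ x. ennreal (norm (g x)) \<partial>M) < \<infinity>" .
qed

text \<open>
  The equation \<open>- div A + G = F\<close> in the distributional sense. Both equations of the system have this
  form: in the first one \<open>A = a \<nabla>u\<close>, \<open>F = f / u\<^sup>\<theta>\<close> and \<open>G = \<psi> u\<^sup>r\<^sup>-\<^sup>1\<close>, in the second one \<open>A = M \<nabla>\<psi>\<close>,
  \<open>F = |u|\<^sup>r\<close> and \<open>G = 0\<close>.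
\<close>

locale weak_equation =
  fixes \<Omega> :: "(real ^ 'n) set" and A :: "real ^ 'n \<Rightarrow> real ^ 'n" and F G :: "real ^ 'n \<Rightarrow> real"
  assumes open_domain: "open \<Omega>"
    and flux: "square_integrable (lebesgue_on \<Omega>) A"
    and measurable_F [measurable]: "F \<in> borel_measurable (lebesgue_on \<Omega>)"
    and measurable_G [measurable]: "G \<in> borel_measurable (lebesgue_on \<Omega>)"
    and nonneg_F: "AE x in lebesgue_on \<Omega>. F x \<ge> 0"
    and nonneg_G: "AE x in lebesgue_on \<Omega>. G x \<ge> 0"
    and integrable_F: "\<phi> \<in> Cc1 \<Omega> \<Longrightarrow> integrable (lebesgue_on \<Omega>) (\<lambda>x. F x * \<phi> x)"
    and integrable_G: "\<phi> \<in> Cc1 \<Omega> \<Longrightarrow> integrable (lebesgue_on \<Omega>) (\<lambda>x. G x * \<phi> x)"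
    and equation: "\<phi> \<in> Cc1 \<Omega> \<Longrightarrow>
      (LINT x|lebesgue_on \<Omega>. A x \<bullet> classical_grad \<phi> x) + (LINT x|lebesgue_on \<Omega>. G x * \<phi> x)
        = (LINT x|lebesgue_on \<Omega>. F x * \<phi> x)"
begin

text \<open>
  The smooth minimum of \<open>\<eta>\<close> and \<open>\<phi>\<^sub>j\<close> is a test function dominated by \<open>2 |\<eta>|\<close>, and \<open>F \<eta>\<close> and \<open>G \<eta>\<close> are
  integrable; so \<open>\<phi>\<^sub>j\<close> can tend to \<open>v\<close> while \<open>\<eta>\<close> is kept.
\<close>

lemma test_smooth_min:
  assumes \<epsilon>: "\<epsilon> > 0" and \<eta>: "\<eta> \<in> Cc1 \<Omega>" and v: "v \<in> W012 \<Omega>"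
  shows "integrable (lebesgue_on \<Omega>) (\<lambda>x. F x * smooth_min \<epsilon> (\<eta> x) (v x))"
    and "integrable (lebesgue_on \<Omega>) (\<lambda>x. G x * smooth_min \<epsilon> (\<eta> x) (v x))"
    and "(LINT x|lebesgue_on \<Omega>. smooth_min_deriv \<epsilon> (\<eta> x) (v x) * (A x \<bullet> classical_grad \<eta> x))
       + (LINT x|lebesgue_on \<Omega>. smooth_min_deriv \<epsilon> (v x) (\<eta> x) * (A x \<bullet> weak_grad \<Omega> v x))
       + (LINT x|lebesgue_on \<Omega>. G x * smooth_min \<epsilon> (\<eta> x) (v x))
       = (LINT x|lebesgue_on \<Omega>. F x * smooth_min \<epsilon> (\<eta> x) (v x))"
proof -
  let ?M = "lebesgue_on \<Omega>"
  note vm [measurable] = W012_weak_grad(1)[OF open_domain v] and vg = W012_weak_grad(2)[OF open_domain v]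
  have \<eta>m [measurable]: "\<eta> \<in> borel_measurable ?M" by (rule Cc1_measurable(1)[OF \<eta>])
  obtain \<phi> where \<phi>: "\<And>j. \<phi> j \<in> Cc1 \<Omega>" "AE x in ?M. (\<lambda>j::nat. \<phi> j x) \<longlonglongrightarrow> v x"
    "(\<lambda>j. LINT x|?M. (norm (classical_grad (\<phi> j) x - weak_grad \<Omega> v x))\<^sup>2) \<longlonglongrightarrow> 0"
    using W012_approximation[OF open_domain v] by blast
  have \<phi>m [measurable]: "\<phi> j \<in> borel_measurable ?M" for j by (rule Cc1_measurable(1)[OF \<phi>(1)])
  note b = smooth_min_bounds[OF \<epsilon>]
  have bound: "\<bar>smooth_min \<epsilon> (\<eta> x) t\<bar> \<le> 2 * \<bar>\<eta> x\<bar>" for x t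
    using b(1,2)[of "\<eta> x" t] by auto
  have lower_order: "integrable ?M (\<lambda>x. H x * smooth_min \<epsilon> (\<eta> x) (v x)) \<and>
      (\<lambda>j. LINT x|?M. H x * smooth_min \<epsilon> (\<eta> x) (\<phi> j x)) \<longlonglongrightarrow> (LINT x|?M. H x * smooth_min \<epsilon> (\<eta> x) (v x))"
    if Hm [measurable]: "H \<in> borel_measurable ?M" and Hi: "integrable ?M (\<lambda>x. H x * \<eta> x)" for H
  proof -
    have m1: "(\<lambda>x. H x * smooth_min \<epsilon> (\<eta> x) (v x)) \<in> borel_measurable ?M" by measurable
    have m2: "(\<lambda>x. H x * smooth_min \<epsilon> (\<eta> x) (\<phi> j x)) \<in> borel_measurable ?M" for j by measurable
    have w: "integrable ?M (\<lambda>x. 2 * \<bar>H x * \<eta> x\<bar>)" using Hi by simp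
    have l: "AE x in ?M. (\<lambda>j. H x * smooth_min \<epsilon> (\<eta> x) (\<phi> j x)) \<longlonglongrightarrow> H x * smooth_min \<epsilon> (\<eta> x) (v x)"
      using \<phi>(2) by eventually_elim (intro tendsto_mult tendsto_const tendsto_smooth_min(1)[OF \<epsilon>])
    have bd: "norm (H x * smooth_min \<epsilon> (\<eta> x) t) \<le> 2 * \<bar>H x * \<eta> x\<bar>" for x t
      using mult_left_mono[OF bound[of x t], of "\<bar>H x\<bar>"] by (simp add: abs_mult)
    have "AE x in ?M. norm (H x * smooth_min \<epsilon> (\<eta> x) (\<phi> j x)) \<le> 2 * \<bar>H x * \<eta> x\<bar>" for j
      using bd by (intro AE_I2)
    note dc = m1 m2 w l this
    show ?thesis
      using integrable_dominated_convergence[OF dc] integral_dominated_convergence[OF dc] by blast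
  qed
  note LF = lower_order[OF measurable_F integrable_F[OF \<eta>]]
  note LG = lower_order[OF measurable_G integrable_G[OF \<eta>]]
  show "integrable ?M (\<lambda>x. F x * smooth_min \<epsilon> (\<eta> x) (v x))"
    and "integrable ?M (\<lambda>x. G x * smooth_min \<epsilon> (\<eta> x) (v x))" using LF LG by auto
  note g\<eta> = Cc1_square_integrable(2)[OF open_domain \<eta>]
  note g\<phi> = Cc1_square_integrable(2)[OF open_domain \<phi>(1)]
  have l1: "AE x in ?M. (\<lambda>j. smooth_min_deriv \<epsilon> (\<eta> x) (\<phi> j x)) \<longlonglongrightarrow> smooth_min_deriv \<epsilon> (\<eta> x) (v x)"
    using \<phi>(2) by eventually_elim (intro tendsto_const tendsto_smooth_min(2)[OF \<epsilon>])
  have l2: "AE x in ?M. (\<lambda>j. smooth_min_deriv \<epsilon> (\<phi> j x) (\<eta> x)) \<longlonglongrightarrow> smooth_min_deriv \<epsilon> (v x) (\<eta> x)"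
    using \<phi>(2) by eventually_elim (intro tendsto_const tendsto_smooth_min(2)[OF \<epsilon>])
  have L1: "(\<lambda>j. LINT x|?M. smooth_min_deriv \<epsilon> (\<eta> x) (\<phi> j x) * (A x \<bullet> classical_grad \<eta> x))
      \<longlonglongrightarrow> (LINT x|?M. smooth_min_deriv \<epsilon> (\<eta> x) (v x) * (A x \<bullet> classical_grad \<eta> x))"
    by (rule tendsto_integral_bounded_times_inner[where C = 2, OF flux g\<eta> g\<eta> _ _ b(4) _ l1]) (simp, measurable)
  have L2: "(\<lambda>j. LINT x|?M. smooth_min_deriv \<epsilon> (\<phi> j x) (\<eta> x) * (A x \<bullet> classical_grad (\<phi> j) x))
      \<longlonglongrightarrow> (LINT x|?M. smooth_min_deriv \<epsilon> (v x) (\<eta> x) * (A x \<bullet> weak_grad \<Omega> v x))"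
    by (rule tendsto_integral_bounded_times_inner[where C = 2, OF flux vg g\<phi> \<phi>(3) _ b(4) _ l2]) measurable
  have eq: "(LINT x|?M. smooth_min_deriv \<epsilon> (\<eta> x) (\<phi> j x) * (A x \<bullet> classical_grad \<eta> x))
      + (LINT x|?M. smooth_min_deriv \<epsilon> (\<phi> j x) (\<eta> x) * (A x \<bullet> classical_grad (\<phi> j) x))
      + (LINT x|?M. G x * smooth_min \<epsilon> (\<eta> x) (\<phi> j x)) = (LINT x|?M. F x * smooth_min \<epsilon> (\<eta> x) (\<phi> j x))" for j
  proof -
    have i1: "integrable ?M (\<lambda>x. smooth_min_deriv \<epsilon> (\<eta> x) (\<phi> j x) * (A x \<bullet> classical_grad \<eta> x))"
      using b(4) by (intro integrable_times_bounded(2)[where B = 2] square_integrable_inner[OF flux g\<eta>]) auto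
    have i2: "integrable ?M (\<lambda>x. smooth_min_deriv \<epsilon> (\<phi> j x) (\<eta> x) * (A x \<bullet> classical_grad (\<phi> j) x))"
      using b(4) by (intro integrable_times_bounded(2)[where B = 2] square_integrable_inner[OF flux g\<phi>]) auto
    note S = smooth_min_Cc1[OF \<epsilon> \<eta> \<phi>(1)[of j]]
    show ?thesis
      using equation[OF S(1)] unfolding S(2)
      by (simp add: inner_add_right i1 i2)
  qed
  show "(LINT x|?M. smooth_min_deriv \<epsilon> (\<eta> x) (v x) * (A x \<bullet> classical_grad \<eta> x))
       + (LINT x|?M. smooth_min_deriv \<epsilon> (v x) (\<eta> x) * (A x \<bullet> weak_grad \<Omega> v x))
       + (LINT x|?M. G x * smooth_min \<epsilon> (\<eta> x) (v x)) = (LINT x|?M. F x * smooth_min \<epsilon> (\<eta> x) (v x))"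
    using tendsto_add[OF tendsto_add[OF L1 L2] conjunct2[OF LG]] conjunct2[OF LF]
    unfolding eq by (rule LIMSEQ_unique)
qed

lemma integrable_flux_positive:
  assumes "v \<in> W012 \<Omega>"
  shows "integrable (lebesgue_on \<Omega>) (\<lambda>x. (if v x > 0 then 1 else 0) * (A x \<bullet> weak_grad \<Omega> v x))"
proof (rule integrable_times_bounded(2)[where B = 1])
  show "integrable (lebesgue_on \<Omega>) (\<lambda>x. A x \<bullet> weak_grad \<Omega> v x)"
    by (rule square_integrable_inner[OF flux W012_weak_grad(2)[OF open_domain assms]])
  show "(\<lambda>x. if v x > 0 then 1 else 0 :: real) \<in> borel_measurable (lebesgue_on \<Omega>)"
    using W012_weak_grad(1)[OF open_domain assms] by measurable
qed simp

text \<open>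
  The test functions are the smooth minima of \<open>\<phi>\<^sub>k\<close> and \<open>v\<close> with \<open>\<epsilon> = 1 / (k + 1)\<close>. They are nonnegative
  and dominated by \<open>2 v\<^sup>+\<close>, which settles the term with \<open>G\<close>; since the gradient terms converge as well,
  the integrals of \<open>F\<close> against them converge, and nonnegativity of \<open>F\<close> gives integrability of the limit.
\<close>

lemma test_positive_part:
  assumes v: "v \<in> W012 \<Omega>" and Gv: "integrable (lebesgue_on \<Omega>) (\<lambda>x. G x * max (v x) 0)"
  shows "integrable (lebesgue_on \<Omega>) (\<lambda>x. F x * max (v x) 0)"
    and "(LINT x|lebesgue_on \<Omega>. F x * max (v x) 0) =
      (LINT x|lebesgue_on \<Omega>. (if v x > 0 then 1 else 0) * (A x \<bullet> weak_grad \<Omega> v x))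
      + (LINT x|lebesgue_on \<Omega>. G x * max (v x) 0)"
proof -
  let ?M = "lebesgue_on \<Omega>"
  note vm [measurable] = W012_weak_grad(1)[OF open_domain v] and vg = W012_weak_grad(2)[OF open_domain v]
  obtain \<phi> where \<phi>: "\<And>j. \<phi> j \<in> Cc1 \<Omega>" "AE x in ?M. (\<lambda>j::nat. \<phi> j x) \<longlonglongrightarrow> v x"
    "(\<lambda>j. LINT x|?M. (norm (classical_grad (\<phi> j) x - weak_grad \<Omega> v x))\<^sup>2) \<longlonglongrightarrow> 0"
    using W012_approximation[OF open_domain v] by blast
  have \<phi>m [measurable]: "\<phi> j \<in> borel_measurable ?M" for j by (rule Cc1_measurable(1)[OF \<phi>(1)])
  define \<epsilon> where "\<epsilon> k = 1 / real (Suc k)" for k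
  have \<epsilon>: "\<And>k. \<epsilon> k > 0" "\<epsilon> \<longlonglongrightarrow> 0"
    by (simp_all add: \<epsilon>_def[abs_def] LIMSEQ_Suc[OF lim_1_over_n] del: of_nat_Suc)
  define w where "w k x = smooth_min (\<epsilon> k) (\<phi> k x) (v x)" for k x
  have wm [measurable]: "w k \<in> borel_measurable ?M" for k unfolding w_def by measurable
  have w: "0 \<le> w k x" "w k x \<le> 2 * max (v x) 0" for k x
    using smooth_min_bounds[OF \<epsilon>(1)[of k]] by (auto simp: w_def)
  have wlim: "AE x in ?M. (\<lambda>k. w k x) \<longlonglongrightarrow> max (v x) 0"
    using \<phi>(2) unfolding w_def by eventually_elim (rule smooth_min_limit(1)[OF \<epsilon>])
  have dominated: "(\<lambda>k. LINT x|?M. H x * w k x) \<longlonglongrightarrow> (LINT x|?M. H x * max (v x) 0)"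
    if [measurable]: "H \<in> borel_measurable ?M" and Hi: "integrable ?M (\<lambda>x. H x * max (v x) 0)" for H
  proof (rule integral_dominated_convergence[where w = "\<lambda>x. 2 * \<bar>H x * max (v x) 0\<bar>"])
    show "integrable ?M (\<lambda>x. 2 * \<bar>H x * max (v x) 0\<bar>)" using Hi by simp
    show "AE x in ?M. (\<lambda>k. H x * w k x) \<longlonglongrightarrow> H x * max (v x) 0"
      using wlim by eventually_elim (intro tendsto_mult tendsto_const)
    show "AE x in ?M. norm (H x * w k x) \<le> 2 * \<bar>H x * max (v x) 0\<bar>" for k
    proof (rule AE_I2)
      fix x
      have "\<bar>w k x\<bar> \<le> 2 * \<bar>max (v x) 0\<bar>" using w[of k x] by auto
      from mult_left_mono[OF this, of "\<bar>H x\<bar>"] show "norm (H x * w k x) \<le> 2 * \<bar>H x * max (v x) 0\<bar>"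
        by (simp add: abs_mult)
    qed
  qed measurable
  note LG = dominated[OF measurable_G Gv]
  note g\<phi> = Cc1_square_integrable(2)[OF open_domain \<phi>(1)]
  let ?c = "\<lambda>x. if v x > 0 then 1 / 2 else 0 :: real"
  let ?I = "LINT x|?M. ?c x * (A x \<bullet> weak_grad \<Omega> v x)"
  have l1: "AE x in ?M. (\<lambda>k. smooth_min_deriv (\<epsilon> k) (\<phi> k x) (v x)) \<longlonglongrightarrow> ?c x"
    using \<phi>(2) by eventually_elim (rule smooth_min_limit(2)[OF \<epsilon>])
  have l2: "AE x in ?M. (\<lambda>k. smooth_min_deriv (\<epsilon> k) (v x) (\<phi> k x)) \<longlonglongrightarrow> ?c x"
    using \<phi>(2) by eventually_elim (rule smooth_min_limit(3)[OF \<epsilon>])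
  have L1: "(\<lambda>k. LINT x|?M. smooth_min_deriv (\<epsilon> k) (\<phi> k x) (v x) * (A x \<bullet> classical_grad (\<phi> k) x)) \<longlonglongrightarrow> ?I"
    by (rule tendsto_integral_bounded_times_inner[where C = 2, OF flux vg g\<phi> \<phi>(3) _ smooth_min_bounds(4)[OF \<epsilon>(1)] _ l1]) measurable
  have L2: "(\<lambda>k. LINT x|?M. smooth_min_deriv (\<epsilon> k) (v x) (\<phi> k x) * (A x \<bullet> weak_grad \<Omega> v x)) \<longlonglongrightarrow> ?I"
    by (rule tendsto_integral_bounded_times_inner[where C = 2, OF flux vg vg _ _ smooth_min_bounds(4)[OF \<epsilon>(1)] _ l2]) (simp, measurable)
  note T = test_smooth_min[OF \<epsilon>(1) \<phi>(1) v]
  have LF: "(\<lambda>k. LINT x|?M. F x * w k x) \<longlonglongrightarrow> ?I + ?I + (LINT x|?M. G x * max (v x) 0)"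
    using tendsto_add[OF tendsto_add[OF L1 L2] LG] unfolding w_def T(3) .
  show iF: "integrable ?M (\<lambda>x. F x * max (v x) 0)"
  proof (rule integrable_limit_of_bounded_integrals[OF _ _ _ LF])
    show "integrable ?M (\<lambda>x. F x * w k x)" for k unfolding w_def by (rule T(1))
    show "AE x in ?M. 0 \<le> F x * w k x" for k
      using nonneg_F by eventually_elim (simp add: w(1))
    show "AE x in ?M. (\<lambda>k. F x * w k x) \<longlonglongrightarrow> F x * max (v x) 0"
      using wlim by eventually_elim (intro tendsto_mult tendsto_const)
  qed measurable
  have "?I + ?I = (LINT x|?M. 2 * (?c x * (A x \<bullet> weak_grad \<Omega> v x)))" by simp
  also have "\<dots> = (LINT x|?M. (if v x > 0 then 1 else 0) * (A x \<bullet> weak_grad \<Omega> v x))"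
    by (intro Bochner_Integration.integral_cong) auto
  finally show "(LINT x|?M. F x * max (v x) 0) =
      (LINT x|?M. (if v x > 0 then 1 else 0) * (A x \<bullet> weak_grad \<Omega> v x))
      + (LINT x|?M. G x * max (v x) 0)"
    using LIMSEQ_unique[OF dominated[OF measurable_F iF] LF] by simp
qed

end

section \<open>Pointwise inequalities\<close>

text \<open>
  Convexity of \<open>t\<^sup>r / r\<close>, in the form of Young's inequality with exponents \<open>r\<close> and \<open>r / (r - 1)\<close> for the
  product of \<open>t\<close> and \<open>u\<^sup>r\<^sup>-\<^sup>1\<close>.
\<close>

lemma powr_ge_tangent:
  fixes r t u :: real
  assumes "r > 1" "u > 0" "t \<ge> 0"
  shows "u powr r / r + u powr (r - 1) * (t - u) \<le> t powr r / r"
proof -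
  have "t * u powr (r - 1) \<le> t powr r / r + (u powr (r - 1)) powr (r / (r - 1)) / (r / (r - 1))"
    using assms by (intro Youngs_inequality) (auto simp: field_simps)
  moreover have "(u powr (r - 1)) powr (r / (r - 1)) = u powr r"
    using assms by (simp add: powr_powr)
  moreover have "u powr r / (r / (r - 1)) = u powr r - u powr r / r"
    using assms by (simp add: field_simps)
  moreover have "u powr (r - 1) * u = u powr r"
    using assms powr_mult_base[of u "r - 1"] by (simp add: mult.commute)
  ultimately show ?thesis by (simp add: algebra_simps)
qed

text \<open>
  Concavity of \<open>t\<^sup>1\<^sup>-\<^sup>\<theta>\<close>: Young's inequality bounds \<open>t\<^sup>1\<^sup>-\<^sup>\<theta> u\<^sup>\<theta>\<close> by \<open>(1 - \<theta>) t + \<theta> u\<close>.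
\<close>

lemma powr_le_tangent:
  fixes \<theta> t u :: real
  assumes "0 < \<theta>" "\<theta> < 1" "u > 0" "t \<ge> 0"
  shows "t powr (1 - \<theta>) \<le> u powr (1 - \<theta>) + (1 - \<theta>) * ((t - u) / u powr \<theta>)"
proof -
  have u: "u / u powr \<theta> = u powr (1 - \<theta>)"
    using assms by (simp add: powr_diff)
  have "t powr (1 - \<theta>) * u powr \<theta> \<le> (1 - \<theta>) * t + \<theta> * u"
  proof (cases "t = 0")
    case False
    then show ?thesis using assms by (intro Youngs_inequality_0) auto
  qed (use assms in simp)
  then have "t powr (1 - \<theta>) \<le> ((1 - \<theta>) * t + \<theta> * u) / u powr \<theta>"
    using assms by (simp add: le_divide_eq)
  also have "\<dots> = u / u powr \<theta> + (1 - \<theta>) * ((t - u) / u powr \<theta>)"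
    using assms by (simp add: field_simps)
  finally show ?thesis by (simp only: u)
qed

text \<open>
  Bound by the larger of the two bases. It shows that \<open>\<psi> u\<^sup>r\<^sup>-\<^sup>1 v\<^sup>+\<close> is integrable as soon as \<open>\<psi> u\<^sup>r\<close> and
  \<open>\<psi> |v|\<^sup>r\<close> are, which is what testing the first equation with \<open>v\<^sup>+\<close> requires.
\<close>

lemma powr_product_bound:
  fixes r s u :: real
  assumes "r > 1" "u > 0" "s \<ge> 0"
  shows "u powr (r - 1) * s \<le> u powr r + s powr r"
proof (cases "s \<le> u")
  case True
  then have "u powr (r - 1) * s \<le> u powr (r - 1) * u" by (intro mult_left_mono) auto
  also have "\<dots> = u powr r" using assms powr_mult_base[of u "r - 1"] by (simp add: mult.commute)
  finally show ?thesis by (simp add: add_increasing2)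
next
  case False
  then have "u powr (r - 1) * s \<le> s powr (r - 1) * s"
    using assms by (intro mult_right_mono powr_mono2) auto
  also have "\<dots> = s powr r" using assms powr_mult_base[of s "r - 1"] by (simp add: mult.commute)
  finally show ?thesis by (simp add: add_increasing)
qed

lemma symmetric_form_le_average:
  fixes B :: "real ^ 'n ^ 'n"
  assumes "transpose B = B" and psd: "\<And>\<xi>. (B *v \<xi>) \<bullet> \<xi> \<ge> 0"
  shows "(B *v \<xi>) \<bullet> \<eta> \<le> ((B *v \<xi>) \<bullet> \<xi> + (B *v \<eta>) \<bullet> \<eta>) / 2"
proof -
  have "(B *v \<eta>) \<bullet> \<xi> = (B *v \<xi>) \<bullet> \<eta>"
    by (metis assms(1) dot_lmul_matrix inner_commute transpose_matrix_vector)
  then show ?thesis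
    using psd[of "\<xi> - \<eta>"] by (simp add: matrix_vector_mult_diff_distrib inner_diff_left inner_diff_right)
qed

lemma norm_matrix_vector_le:
  fixes B :: "real ^ 'n ^ 'm"
  shows "norm (B *v x) \<le> real CARD('m) * norm B * norm x"
proof -
  have "norm (B *v x) \<le> (\<Sum>i\<in>UNIV. \<bar>(B *v x) $ i\<bar>)" by (rule norm_le_l1_cart)
  also have "\<dots> \<le> (\<Sum>i\<in>(UNIV :: 'm set). norm B * norm x)"
  proof (rule sum_mono)
    fix i
    have "\<bar>(B *v x) $ i\<bar> \<le> norm (B $ i) * norm x"
      unfolding matrix_vector_mul_component by (rule Cauchy_Schwarz_ineq2)
    also have "\<dots> \<le> norm B * norm x"
      by (intro mult_right_mono Finite_Cartesian_Product.norm_nth_le) auto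
    finally show "\<bar>(B *v x) $ i\<bar> \<le> norm B * norm x" .
  qed
  finally show ?thesis by simp
qed

lemma borel_measurable_matrix_vector:
  fixes B :: "'a \<Rightarrow> real ^ 'n ^ 'm"
  assumes "B \<in> borel_measurable M" "g \<in> borel_measurable M"
  shows "(\<lambda>x. B x *v g x) \<in> borel_measurable M"
proof (rule borel_measurable_continuous_Pair[OF assms, where H = "\<lambda>B x. B *v x"])
  show "continuous_on UNIV (\<lambda>x. fst x *v snd x :: real ^ 'm)"
    unfolding matrix_vector_mult_def by (intro continuous_intros)
qed

section \<open>The two halves of the saddle point inequality\<close>

text \<open>
  With \<open>P w\<close> and \<open>Q w\<close> for the integrals of \<open>w\<^sup>+ F\<close> and \<open>M \<nabla>w \<bullet> \<nabla>w\<close>: for \<open>\<phi> = \<psi>\<close>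
  the tested equation is the energy identity \<open>P \<psi> = Q \<psi>\<close>, and for general \<open>\<phi>\<close> it gives
  \<open>P \<phi> \<le> (Q \<psi> + Q \<phi>) / 2\<close>. Hence \<open>P \<phi> - Q \<phi> / 2 \<le> Q \<psi> / 2 = P \<psi> - Q \<psi> / 2\<close>.
\<close>

lemma potential_maximizes:
  fixes M :: "real ^ 'n \<Rightarrow> real ^ 'n ^ 'n"
  assumes "open \<Omega>" and r: "r > 0"
    and Mm: "M \<in> borel_measurable (lebesgue_on \<Omega>)"
    and sym: "AE x in lebesgue_on \<Omega>. transpose (M x) = M x"
    and ell: "AE x in lebesgue_on \<Omega>. (\<forall>\<xi>. (M x *v \<xi>) \<bullet> \<xi> \<ge> 0) \<and> norm (M x) \<le> \<beta>"
    and F: "F \<in> borel_measurable (lebesgue_on \<Omega>)" "\<And>x. F x \<ge> 0"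
    and \<psi>: "\<psi> \<in> W012 \<Omega>" "AE x in lebesgue_on \<Omega>. \<psi> x > 0"
    and eq: "\<forall>\<phi>\<in>Cc1 \<Omega>. integrable (lebesgue_on \<Omega>) (\<lambda>x. F x * \<phi> x) \<and>
        (LINT x|lebesgue_on \<Omega>. (M x *v weak_grad \<Omega> \<psi> x) \<bullet> classical_grad \<phi> x)
          = (LINT x|lebesgue_on \<Omega>. F x * \<phi> x)"
    and \<phi>: "\<phi> \<in> W012 \<Omega>"
  shows "integrable (lebesgue_on \<Omega>) (\<lambda>x. pos_part (\<phi> x) * F x)"
    and "1 / r * (LINT x|lebesgue_on \<Omega>. pos_part (\<phi> x) * F x)
        - 1 / (2 * r) * (LINT x|lebesgue_on \<Omega>. (M x *v weak_grad \<Omega> \<phi> x) \<bullet> weak_grad \<Omega> \<phi> x)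
      \<le> 1 / r * (LINT x|lebesgue_on \<Omega>. pos_part (\<psi> x) * F x)
        - 1 / (2 * r) * (LINT x|lebesgue_on \<Omega>. (M x *v weak_grad \<Omega> \<psi> x) \<bullet> weak_grad \<Omega> \<psi> x)"
proof -
  let ?L = "lebesgue_on \<Omega>"
  note meas = W012_weak_grad(1)[OF assms(1)] and g = W012_weak_grad(2)[OF assms(1)]
  have flux_W012: "square_integrable ?L (\<lambda>x. M x *v weak_grad \<Omega> w x)" if "w \<in> W012 \<Omega>" for w
  proof (rule square_integrable_norm_bound[OF g[OF that], where C = "real CARD('n) * \<beta>"])
    show "(\<lambda>x. M x *v weak_grad \<Omega> w x) \<in> borel_measurable ?L"
      using g[OF that] by (intro borel_measurable_matrix_vector Mm) (simp add: square_integrable_def)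
    show "AE x in ?L. norm (M x *v weak_grad \<Omega> w x) \<le> real CARD('n) * \<beta> * norm (weak_grad \<Omega> w x)"
      using ell
    proof eventually_elim
      case (elim x)
      have "norm (M x *v weak_grad \<Omega> w x) \<le> real CARD('n) * norm (M x) * norm (weak_grad \<Omega> w x)"
        by (rule norm_matrix_vector_le)
      also have "\<dots> \<le> real CARD('n) * \<beta> * norm (weak_grad \<Omega> w x)"
        using elim by (intro mult_right_mono mult_left_mono) auto
      finally show ?case .
    qed
  qed
  interpret weak_equation \<Omega> "\<lambda>x. M x *v weak_grad \<Omega> \<psi> x" F "\<lambda>x. 0"
    by unfold_locales (use assms(1) F eq flux_W012[OF \<psi>(1)] in auto)
  have T: "integrable ?L (\<lambda>x. F x * max (w x) 0)"
    "(LINT x|?L. F x * max (w x) 0) =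
      (LINT x|?L. (if w x > 0 then 1 else 0) * ((M x *v weak_grad \<Omega> \<psi> x) \<bullet> weak_grad \<Omega> w x))"
    if "w \<in> W012 \<Omega>" for w
    using test_positive_part[OF that] by simp_all
  show "integrable ?L (\<lambda>x. pos_part (\<phi> x) * F x)"
    using T(1)[OF \<phi>] by (simp add: pos_part_def mult.commute)
  define Q where "Q w = (LINT x|?L. (M x *v weak_grad \<Omega> w x) \<bullet> weak_grad \<Omega> w x)" for w
  define P where "P w = (LINT x|?L. pos_part (w x) * F x)" for w
  have Qi: "integrable ?L (\<lambda>x. (M x *v weak_grad \<Omega> w x) \<bullet> weak_grad \<Omega> w x)" if "w \<in> W012 \<Omega>" for w
    by (rule square_integrable_inner[OF flux_W012[OF that] g[OF that]])
  note Bi = integrable_flux_positive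
  have "P \<psi> = Q \<psi>"
  proof -
    have "P \<psi> = (LINT x|?L. (if \<psi> x > 0 then 1 else 0) * ((M x *v weak_grad \<Omega> \<psi> x) \<bullet> weak_grad \<Omega> \<psi> x))"
      using T(2)[OF \<psi>(1)] by (simp add: P_def pos_part_def mult.commute)
    also have "\<dots> = Q \<psi>"
      unfolding Q_def using \<psi>(2) Bi[OF \<psi>(1)] Qi[OF \<psi>(1)]
      by (intro integral_cong_AE) (auto elim!: eventually_mono)
    finally show ?thesis .
  qed
  moreover have "P \<phi> \<le> (Q \<psi> + Q \<phi>) / 2"
  proof -
    have "P \<phi> = (LINT x|?L. (if \<phi> x > 0 then 1 else 0) * ((M x *v weak_grad \<Omega> \<psi> x) \<bullet> weak_grad \<Omega> \<phi> x))"
      using T(2)[OF \<phi>] by (simp add: P_def pos_part_def mult.commute)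
    also have "\<dots> \<le> (LINT x|?L. ((M x *v weak_grad \<Omega> \<psi> x) \<bullet> weak_grad \<Omega> \<psi> x + (M x *v weak_grad \<Omega> \<phi> x) \<bullet> weak_grad \<Omega> \<phi> x) / 2)"
    proof (rule integral_mono_AE[OF Bi[OF \<phi>]])
      show "integrable ?L (\<lambda>x. ((M x *v weak_grad \<Omega> \<psi> x) \<bullet> weak_grad \<Omega> \<psi> x + (M x *v weak_grad \<Omega> \<phi> x) \<bullet> weak_grad \<Omega> \<phi> x) / 2)"
        using Qi[OF \<psi>(1)] Qi[OF \<phi>] by simp
      show "AE x in ?L. (if \<phi> x > 0 then 1 else 0) * ((M x *v weak_grad \<Omega> \<psi> x) \<bullet> weak_grad \<Omega> \<phi> x)
          \<le> ((M x *v weak_grad \<Omega> \<psi> x) \<bullet> weak_grad \<Omega> \<psi> x + (M x *v weak_grad \<Omega> \<phi> x) \<bullet> weak_grad \<Omega> \<phi> x) / 2"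
        using sym ell
      proof eventually_elim
        case (elim x)
        then show ?case
          using symmetric_form_le_average[of "M x" "weak_grad \<Omega> \<psi> x" "weak_grad \<Omega> \<phi> x"] by auto
      qed
    qed
    also have "\<dots> = (Q \<psi> + Q \<phi>) / 2"
      using Qi[OF \<psi>(1)] Qi[OF \<phi>] by (simp add: Q_def)
    finally show ?thesis .
  qed
  ultimately have "1 / r * (P \<phi> - Q \<phi> / 2) \<le> 1 / r * (P \<psi> - Q \<psi> / 2)"
    using r by (intro mult_left_mono) auto
  then show "1 / r * (LINT x|?L. pos_part (\<phi> x) * F x)
        - 1 / (2 * r) * (LINT x|?L. (M x *v weak_grad \<Omega> \<phi> x) \<bullet> weak_grad \<Omega> \<phi> x)
      \<le> 1 / r * (LINT x|?L. pos_part (\<psi> x) * F x)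
        - 1 / (2 * r) * (LINT x|?L. (M x *v weak_grad \<Omega> \<psi> x) \<bullet> weak_grad \<Omega> \<psi> x)"
    unfolding P_def[symmetric] Q_def[symmetric] by (simp add: right_diff_distrib)
qed

text \<open>
  From \<open>u\<close> to \<open>v\<close>, the three terms of the functional increase at least by the integrals of their
  linearizations, called \<open>E\<close>, \<open>H\<close> and \<open>- D\<close> in the proof. The difference of the equation tested with
  \<open>v\<^sup>+\<close> and with \<open>u\<close> says that the integral of \<open>D\<close> is the sum of those of \<open>E\<close> and \<open>H\<close>.
\<close>

lemma state_minimizes:
  fixes u v \<psi> f a :: "real ^ 'n \<Rightarrow> real"
  assumes "open \<Omega>" and \<theta>: "0 < \<theta>" "\<theta> < 1" and r: "r > 1" and "\<alpha> \<ge> 0"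
    and am [measurable]: "a \<in> borel_measurable (lebesgue_on \<Omega>)"
    and ab: "AE x in lebesgue_on \<Omega>. \<alpha> \<le> a x \<and> a x \<le> \<beta>"
    and fm [measurable]: "f \<in> borel_measurable (lebesgue_on \<Omega>)"
    and f0: "AE x in lebesgue_on \<Omega>. f x \<ge> 0"
    and \<psi>m [measurable]: "\<psi> \<in> borel_measurable (lebesgue_on \<Omega>)"
    and \<psi>0: "AE x in lebesgue_on \<Omega>. \<psi> x > 0"
    and u: "u \<in> W012 \<Omega>" and u0: "AE x in lebesgue_on \<Omega>. u x > 0"
    and eq: "\<And>\<phi>. \<phi> \<in> Cc1 \<Omega> \<Longrightarrow>
        integrable (lebesgue_on \<Omega>) (\<lambda>x. \<psi> x * \<bar>u x\<bar> powr (r - 2) * u x * \<phi> x) \<and>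
        integrable (lebesgue_on \<Omega>) (\<lambda>x. f x / u x powr \<theta> * \<phi> x) \<and>
        (LINT x|lebesgue_on \<Omega>. a x * (weak_grad \<Omega> u x \<bullet> classical_grad \<phi> x))
          + (LINT x|lebesgue_on \<Omega>. \<psi> x * \<bar>u x\<bar> powr (r - 2) * u x * \<phi> x)
          = (LINT x|lebesgue_on \<Omega>. f x / u x powr \<theta> * \<phi> x)"
    and \<psi>u: "integrable (lebesgue_on \<Omega>) (\<lambda>x. \<psi> x * \<bar>u x\<bar> powr r)"
    and v: "v \<in> W012 \<Omega>"
    and \<psi>v: "integrable (lebesgue_on \<Omega>) (\<lambda>x. \<psi> x * \<bar>v x\<bar> powr r)"
  shows "1 / 2 * (LINT x|lebesgue_on \<Omega>. a x * (norm (weak_grad \<Omega> u x))\<^sup>2)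
      + 1 / r * (LINT x|lebesgue_on \<Omega>. \<psi> x * \<bar>u x\<bar> powr r)
      - 1 / (1 - \<theta>) * (LINT x|lebesgue_on \<Omega>. f x * pos_part (u x) powr (1 - \<theta>))
    \<le> 1 / 2 * (LINT x|lebesgue_on \<Omega>. a x * (norm (weak_grad \<Omega> v x))\<^sup>2)
      + 1 / r * (LINT x|lebesgue_on \<Omega>. \<psi> x * \<bar>v x\<bar> powr r)
      - 1 / (1 - \<theta>) * (LINT x|lebesgue_on \<Omega>. f x * pos_part (v x) powr (1 - \<theta>))"
proof -
  let ?L = "lebesgue_on \<Omega>"
  let ?A = "\<lambda>x. a x *\<^sub>R weak_grad \<Omega> u x"
  let ?F = "\<lambda>x. f x / u x powr \<theta>"
  let ?G = "\<lambda>x. \<psi> x * \<bar>u x\<bar> powr (r - 2) * u x"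
  note meas = W012_weak_grad(1)[OF assms(1)] and g = W012_weak_grad(2)[OF assms(1)]
  note um [measurable] = meas[OF u] and vm [measurable] = meas[OF v]
  have gm [measurable]: "weak_grad \<Omega> u \<in> borel_measurable ?L" "weak_grad \<Omega> v \<in> borel_measurable ?L"
    using g[OF u] g[OF v] by (auto simp: square_integrable_def)
  have G_eq: "AE x in ?L. ?G x = \<psi> x * u x powr (r - 1)"
    using u0
  proof eventually_elim
    case (elim x)
    then show ?case using powr_mult_base[of "u x" "r - 2"] by (simp add: mult.commute)
  qed
  interpret weak_equation \<Omega> ?A ?F ?G
  proof
    show "open \<Omega>" by (rule assms(1))
    show "square_integrable ?L ?A"
    proof (rule square_integrable_norm_bound[OF g[OF u], where C = \<beta>])
      show "AE x in ?L. norm (?A x) \<le> \<beta> * norm (weak_grad \<Omega> u x)"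
        using ab by eventually_elim (use \<open>\<alpha> \<ge> 0\<close> in \<open>auto intro!: mult_right_mono\<close>)
    qed measurable
    show "AE x in ?L. 0 \<le> ?F x" using f0 by eventually_elim simp
    show "AE x in ?L. 0 \<le> ?G x" using u0 \<psi>0 by eventually_elim simp
    fix \<phi> assume "\<phi> \<in> Cc1 \<Omega>"
    from eq[OF this] show "integrable ?L (\<lambda>x. ?F x * \<phi> x)" "integrable ?L (\<lambda>x. ?G x * \<phi> x)"
      "(LINT x|?L. ?A x \<bullet> classical_grad \<phi> x) + (LINT x|?L. ?G x * \<phi> x) = (LINT x|?L. ?F x * \<phi> x)"
      by simp_all
  qed measurable
  have Gw: "integrable ?L (\<lambda>x. ?G x * max (w x) 0)"
    if w: "w \<in> W012 \<Omega>" "integrable ?L (\<lambda>x. \<psi> x * \<bar>w x\<bar> powr r)" for w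
  proof (rule Bochner_Integration.integrable_bound[OF Bochner_Integration.integrable_add[OF \<psi>u w(2)]])
    show "(\<lambda>x. ?G x * max (w x) 0) \<in> borel_measurable ?L" using meas[OF w(1)] by measurable
    show "AE x in ?L. norm (?G x * max (w x) 0) \<le> norm (\<psi> x * \<bar>u x\<bar> powr r + \<psi> x * \<bar>w x\<bar> powr r)"
      using u0 \<psi>0 G_eq
    proof eventually_elim
      case (elim x)
      have "u x powr (r - 1) * max (w x) 0 \<le> u x powr (r - 1) * \<bar>w x\<bar>"
        by (intro mult_left_mono) auto
      also have "\<dots> \<le> u x powr r + \<bar>w x\<bar> powr r"
        using elim r by (intro powr_product_bound) auto
      finally have "\<psi> x * (u x powr (r - 1) * max (w x) 0) \<le> \<psi> x * (u x powr r + \<bar>w x\<bar> powr r)"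
        using elim by (intro mult_left_mono) auto
      then show ?case using elim by (simp add: abs_mult distrib_left mult.assoc)
    qed
  qed
  note Gu = Gw[OF u \<psi>u] and Gv = Gw[OF v \<psi>v]
  note Tu = test_positive_part[OF u Gu] and Tv = test_positive_part[OF v Gv]
  note AI = integrable_flux_positive
  have energy: "integrable ?L (\<lambda>x. a x * (norm (weak_grad \<Omega> w x))\<^sup>2)" if "w \<in> W012 \<Omega>" for w
  proof (rule integrable_times_bounded(2)[where B = \<beta>])
    show "integrable ?L (\<lambda>x. (norm (weak_grad \<Omega> w x))\<^sup>2)"
      using g[OF that] by (simp add: square_integrable_def)
    show "AE x in ?L. \<bar>a x\<bar> \<le> \<beta>" using ab by eventually_elim (use \<open>\<alpha> \<ge> 0\<close> in auto)
  qed (rule am)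
  have fu: "integrable ?L (\<lambda>x. f x * pos_part (u x) powr (1 - \<theta>))"
  proof -
    have "AE x in ?L. ?F x * max (u x) 0 = f x * pos_part (u x) powr (1 - \<theta>)"
      using u0
    proof eventually_elim
      case (elim x)
      then show ?case by (simp add: pos_part_def max_def powr_diff)
    qed
    moreover have "(\<lambda>x. f x * pos_part (u x) powr (1 - \<theta>)) \<in> borel_measurable ?L"
      unfolding pos_part_def by measurable
    ultimately show ?thesis using integrable_cong_AE_imp[OF Tu(1)] by blast
  qed
  let ?D = "\<lambda>x. ?F x * max (v x) 0 - ?F x * max (u x) 0"
  have tangent: "AE x in ?L. f x * pos_part (v x) powr (1 - \<theta>)
      \<le> f x * pos_part (u x) powr (1 - \<theta>) + (1 - \<theta>) * ?D x"
    using u0 f0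
  proof eventually_elim
    case (elim x)
    have "f x * pos_part (v x) powr (1 - \<theta>)
      \<le> f x * (pos_part (u x) powr (1 - \<theta>) + (1 - \<theta>) * ((pos_part (v x) - u x) / u x powr \<theta>))"
      using elim powr_le_tangent[OF \<theta>, of "u x" "pos_part (v x)"]
      by (intro mult_left_mono) (auto simp: pos_part_def max_def)
    also have "\<dots> = f x * pos_part (u x) powr (1 - \<theta>) + (1 - \<theta>) * ?D x"
      using elim by (simp add: pos_part_def field_simps)
    finally show ?case .
  qed
  have fv: "integrable ?L (\<lambda>x. f x * pos_part (v x) powr (1 - \<theta>))"
  proof (rule Bochner_Integration.integrable_bound)
    show "integrable ?L (\<lambda>x. f x * pos_part (u x) powr (1 - \<theta>) + (1 - \<theta>) * ?D x)"
      using fu Tu(1) Tv(1) by simp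
    show "(\<lambda>x. f x * pos_part (v x) powr (1 - \<theta>)) \<in> borel_measurable ?L"
      unfolding pos_part_def by measurable
    show "AE x in ?L. norm (f x * pos_part (v x) powr (1 - \<theta>))
        \<le> norm (f x * pos_part (u x) powr (1 - \<theta>) + (1 - \<theta>) * ?D x)"
      using tangent f0
    proof eventually_elim
      case (elim x)
      have "0 \<le> f x * pos_part (v x) powr (1 - \<theta>)" using elim by simp
      then show ?case using elim(1) unfolding real_norm_def by linarith
    qed
  qed
  let ?c = "\<lambda>w x. if w x > 0 then 1 else 0 :: real"
  let ?E = "\<lambda>x. ?c v x * (?A x \<bullet> weak_grad \<Omega> v x) - ?c u x * (?A x \<bullet> weak_grad \<Omega> u x)"
  let ?H = "\<lambda>x. ?G x * max (v x) 0 - ?G x * max (u x) 0"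
  have "1 / 2 * (LINT x|?L. a x * (norm (weak_grad \<Omega> u x))\<^sup>2) + (LINT x|?L. ?E x)
      = (LINT x|?L. 1 / 2 * (a x * (norm (weak_grad \<Omega> u x))\<^sup>2) + ?E x)"
    using energy[OF u] AI[OF u] AI[OF v] by simp
  also have "\<dots> \<le> (LINT x|?L. 1 / 2 * (a x * (norm (weak_grad \<Omega> v x))\<^sup>2))"
  proof (rule integral_mono_AE)
    show "AE x in ?L. 1 / 2 * (a x * (norm (weak_grad \<Omega> u x))\<^sup>2) + ?E x \<le> 1 / 2 * (a x * (norm (weak_grad \<Omega> v x))\<^sup>2)"
      using u0 ab
    proof eventually_elim
      case (elim x)
      let ?p = "weak_grad \<Omega> u x" and ?q = "weak_grad \<Omega> v x"
      have a0: "a x \<ge> 0" using elim \<open>\<alpha> \<ge> 0\<close> by linarith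
      \<comment> \<open>Only the part of \<open>\<nabla>v\<close> on \<open>{v > 0}\<close> is compared with \<open>\<nabla>u\<close>; the rest has nonnegative energy.\<close>
      have "0 \<le> (norm (?p - ?c v x *\<^sub>R ?q))\<^sup>2" by simp
      also have "\<dots> \<le> (norm ?p)\<^sup>2 - 2 * (?c v x * (?p \<bullet> ?q)) + (norm ?q)\<^sup>2"
        by (simp add: power2_norm_eq_inner inner_diff_left inner_diff_right inner_commute)
      finally have "0 \<le> a x * ((norm ?p)\<^sup>2 - 2 * (?c v x * (?p \<bullet> ?q)) + (norm ?q)\<^sup>2)"
        using a0 by (rule mult_nonneg_nonneg[rotated])
      then show ?case using elim(1)
        by (simp add: power2_norm_eq_inner algebra_simps split: if_splits)
    qed
  qed (use energy[OF u] energy[OF v] AI[OF u] AI[OF v] in simp_all)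
  finally have 1: "1 / 2 * (LINT x|?L. a x * (norm (weak_grad \<Omega> u x))\<^sup>2) + (LINT x|?L. ?E x)
      \<le> 1 / 2 * (LINT x|?L. a x * (norm (weak_grad \<Omega> v x))\<^sup>2)" by simp
  have "1 / r * (LINT x|?L. \<psi> x * \<bar>u x\<bar> powr r) + (LINT x|?L. ?H x)
      = (LINT x|?L. 1 / r * (\<psi> x * \<bar>u x\<bar> powr r) + ?H x)"
    using \<psi>u Gu Gv by simp
  also have "\<dots> \<le> (LINT x|?L. 1 / r * (\<psi> x * \<bar>v x\<bar> powr r))"
  proof (rule integral_mono_AE)
    show "AE x in ?L. 1 / r * (\<psi> x * \<bar>u x\<bar> powr r) + ?H x \<le> 1 / r * (\<psi> x * \<bar>v x\<bar> powr r)"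
      using u0 \<psi>0 G_eq
    proof eventually_elim
      case (elim x)
      have "u x powr r / r + u x powr (r - 1) * (max (v x) 0 - u x) \<le> max (v x) 0 powr r / r"
        using elim r by (intro powr_ge_tangent) auto
      also have "\<dots> \<le> \<bar>v x\<bar> powr r / r"
        using r by (intro divide_right_mono powr_mono2) auto
      finally have "\<psi> x * (u x powr r / r + u x powr (r - 1) * (max (v x) 0 - u x)) \<le> \<psi> x * (\<bar>v x\<bar> powr r / r)"
        using elim by (intro mult_left_mono) auto
      then show ?case using elim by (simp add: algebra_simps)
    qed
  qed (use \<psi>u \<psi>v Gu Gv in simp_all)
  finally have 2: "1 / r * (LINT x|?L. \<psi> x * \<bar>u x\<bar> powr r) + (LINT x|?L. ?H x)
      \<le> 1 / r * (LINT x|?L. \<psi> x * \<bar>v x\<bar> powr r)" by simp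
  have "(LINT x|?L. f x * pos_part (v x) powr (1 - \<theta>))
      \<le> (LINT x|?L. f x * pos_part (u x) powr (1 - \<theta>) + (1 - \<theta>) * ?D x)"
    using fv fu Tu(1) Tv(1) tangent by (intro integral_mono_AE) simp_all
  also have "\<dots> = (LINT x|?L. f x * pos_part (u x) powr (1 - \<theta>)) + (1 - \<theta>) * (LINT x|?L. ?D x)"
    using fu Tu(1) Tv(1) by simp
  finally have "1 / (1 - \<theta>) * (LINT x|?L. f x * pos_part (v x) powr (1 - \<theta>))
      \<le> 1 / (1 - \<theta>) * ((LINT x|?L. f x * pos_part (u x) powr (1 - \<theta>)) + (1 - \<theta>) * (LINT x|?L. ?D x))"
    using \<theta> by (intro mult_left_mono) auto
  also have "\<dots> = 1 / (1 - \<theta>) * (LINT x|?L. f x * pos_part (u x) powr (1 - \<theta>)) + (LINT x|?L. ?D x)"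
    using \<theta> by (simp only: distrib_left) simp
  finally have 3: "1 / (1 - \<theta>) * (LINT x|?L. f x * pos_part (v x) powr (1 - \<theta>))
      \<le> 1 / (1 - \<theta>) * (LINT x|?L. f x * pos_part (u x) powr (1 - \<theta>)) + (LINT x|?L. ?D x)" .
  have 4: "(LINT x|?L. ?D x) = (LINT x|?L. ?E x) + (LINT x|?L. ?H x)"
  proof -
    have "(LINT x|?L. ?D x) = (LINT x|?L. ?F x * max (v x) 0) - (LINT x|?L. ?F x * max (u x) 0)"
      by (rule Bochner_Integration.integral_diff[OF Tv(1) Tu(1)])
    moreover have "(LINT x|?L. ?E x) = (LINT x|?L. ?c v x * (?A x \<bullet> weak_grad \<Omega> v x)) - (LINT x|?L. ?c u x * (?A x \<bullet> weak_grad \<Omega> u x))"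
      by (rule Bochner_Integration.integral_diff[OF AI[OF v] AI[OF u]])
    moreover have "(LINT x|?L. ?H x) = (LINT x|?L. ?G x * max (v x) 0) - (LINT x|?L. ?G x * max (u x) 0)"
      by (rule Bochner_Integration.integral_diff[OF Gv Gu])
    ultimately show ?thesis using Tu(2) Tv(2) by linarith
  qed
  show ?thesis using 1 2 3 4 by linarith
qed

theorem theorem3p1:
  fixes \<Omega> :: "(real ^ 'n) set"
    and a f u \<psi> :: "real ^ 'n \<Rightarrow> real"
    and M :: "real ^ 'n \<Rightarrow> real ^ 'n ^ 'n"
    and \<theta> \<alpha> \<beta> r :: real and m :: ereal
  assumes "CARD('n) > 2"
    and "open \<Omega>" and "bounded \<Omega>"
    and "0 < \<theta>" and "\<theta> < 1"
    and "0 < \<alpha>" and "\<alpha> \<le> \<beta>"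
    and "a \<in> borel_measurable (lebesgue_on \<Omega>)"
    and "AE x in lebesgue_on \<Omega>. \<alpha> \<le> a x \<and> a x \<le> \<beta>"
    and "M \<in> borel_measurable (lebesgue_on \<Omega>)"
    and "AE x in lebesgue_on \<Omega>. transpose (M x) = M x"
    and "AE x in lebesgue_on \<Omega>. (\<forall>\<xi>. (M x *v \<xi>) \<bullet> \<xi> \<ge> \<alpha> * (norm \<xi>)\<^sup>2) \<and> norm (M x) \<le> \<beta>"
    and "1 < r"
    and "r \<le> 2 * real CARD('n) / (real CARD('n) + 2 + (real CARD('n) - 2) * \<theta>)"
    and "m \<ge> ereal (conj_exp (sobolev_exp CARD('n) / (1 - \<theta>)))"
    and "f \<in> L_space m \<Omega>"
    and "AE x in lebesgue_on \<Omega>. f x \<ge> 0"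
    and "\<not> (AE x in lebesgue_on \<Omega>. f x = 0)"
    and "is_solution_by_approximation \<Omega> a M f r \<theta> u \<psi>"
  shows "\<forall>v \<in> W012 \<Omega>. \<forall>\<phi> \<in> W012 \<Omega>.
           integrable (lebesgue_on \<Omega>) (\<lambda>x. \<psi> x * \<bar>v x\<bar> powr r) \<longrightarrow>
             J_functional \<Omega> a M f r \<theta> u \<phi> \<le> J_functional \<Omega> a M f r \<theta> u \<psi> \<and>
             J_functional \<Omega> a M f r \<theta> u \<psi> \<le> J_functional \<Omega> a M f r \<theta> v \<psi>"
proof (intro ballI impI)
  fix v \<phi> assume v: "v \<in> W012 \<Omega>" and \<phi>: "\<phi> \<in> W012 \<Omega>"
    and \<psi>v: "integrable (lebesgue_on \<Omega>) (\<lambda>x. \<psi> x * \<bar>v x\<bar> powr r)"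
  let ?L = "lebesgue_on \<Omega>"
  have sol: "is_solution \<Omega> a M f r \<theta> u \<psi>"
    using assms(19) by (simp add: is_solution_by_approximation_def)
  then have u: "u \<in> W012 \<Omega>" "AE x in ?L. u x > 0" and \<psi>: "\<psi> \<in> W012 \<Omega>" "AE x in ?L. \<psi> x > 0"
    by (auto simp: is_solution_def)
  note measurable_W012 = W012_weak_grad(1)[OF assms(2)]
  have um: "(\<lambda>x. \<bar>u x\<bar> powr r) \<in> borel_measurable ?L" using measurable_W012[OF u(1)] by measurable
  have ell: "AE x in ?L. (\<forall>\<xi>. (M x *v \<xi>) \<bullet> \<xi> \<ge> 0) \<and> norm (M x) \<le> \<beta>"
    using assms(12)
  proof eventually_elim
    case (elim x)
    have "0 \<le> \<alpha> * (norm \<xi>)\<^sup>2" for \<xi> :: "real ^ 'n" using assms(6) by simp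
    then show ?case using elim order_trans by blast
  qed
  have eq2: "\<forall>\<eta>\<in>Cc1 \<Omega>. integrable ?L (\<lambda>x. \<bar>u x\<bar> powr r * \<eta> x) \<and>
      (LINT x|?L. (M x *v weak_grad \<Omega> \<psi> x) \<bullet> classical_grad \<eta> x) = (LINT x|?L. \<bar>u x\<bar> powr r * \<eta> x)"
    using sol by (simp add: is_solution_def)
  have "r > 0" using assms(13) by simp
  note maximal = potential_maximizes[OF assms(2) \<open>r > 0\<close> assms(10,11) ell um powr_ge_zero \<psi> eq2]
  have pos: "(LINT x|?L. pos_part (\<psi> x) * \<bar>w x\<bar> powr r) = (LINT x|?L. \<psi> x * \<bar>w x\<bar> powr r)"
      "integrable ?L (\<lambda>x. pos_part (\<psi> x) * \<bar>w x\<bar> powr r) \<longleftrightarrow> integrable ?L (\<lambda>x. \<psi> x * \<bar>w x\<bar> powr r)"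
    if "w \<in> W012 \<Omega>" for w
  proof -
    have m: "(\<lambda>x. pos_part (\<psi> x) * \<bar>w x\<bar> powr r) \<in> borel_measurable ?L"
      "(\<lambda>x. \<psi> x * \<bar>w x\<bar> powr r) \<in> borel_measurable ?L"
      using measurable_W012[OF that] measurable_W012[OF \<psi>(1)] unfolding pos_part_def by measurable
    have e: "AE x in ?L. pos_part (\<psi> x) * \<bar>w x\<bar> powr r = \<psi> x * \<bar>w x\<bar> powr r"
      using \<psi>(2) by eventually_elim (simp add: pos_part_def)
    show "(LINT x|?L. pos_part (\<psi> x) * \<bar>w x\<bar> powr r) = (LINT x|?L. \<psi> x * \<bar>w x\<bar> powr r)"
      by (rule integral_cong_AE[OF m e])
    show "integrable ?L (\<lambda>x. pos_part (\<psi> x) * \<bar>w x\<bar> powr r) \<longleftrightarrow> integrable ?L (\<lambda>x. \<psi> x * \<bar>w x\<bar> powr r)"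
      by (rule integrable_cong_AE[OF m e])
  qed
  have \<psi>u: "integrable ?L (\<lambda>x. \<psi> x * \<bar>u x\<bar> powr r)"
    using maximal(1)[OF \<psi>(1)] pos(2)[OF u(1)] by simp
  have fm: "f \<in> borel_measurable ?L" using assms(16) by (simp add: L_space_def)
  have "0 \<le> \<alpha>" using assms(6) by simp
  have minimal: "1 / 2 * (LINT x|?L. a x * (norm (weak_grad \<Omega> u x))\<^sup>2)
      + 1 / r * (LINT x|?L. \<psi> x * \<bar>u x\<bar> powr r)
      - 1 / (1 - \<theta>) * (LINT x|?L. f x * pos_part (u x) powr (1 - \<theta>))
    \<le> 1 / 2 * (LINT x|?L. a x * (norm (weak_grad \<Omega> v x))\<^sup>2)
      + 1 / r * (LINT x|?L. \<psi> x * \<bar>v x\<bar> powr r)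
      - 1 / (1 - \<theta>) * (LINT x|?L. f x * pos_part (v x) powr (1 - \<theta>))"
  proof (rule state_minimizes[OF assms(2,4,5,13) \<open>0 \<le> \<alpha>\<close> assms(8,9) fm assms(17)
        measurable_W012[OF \<psi>(1)] \<psi>(2) u _ \<psi>u v \<psi>v])
    fix \<eta> assume "\<eta> \<in> Cc1 \<Omega>"
    then show "integrable ?L (\<lambda>x. \<psi> x * \<bar>u x\<bar> powr (r - 2) * u x * \<eta> x) \<and>
        integrable ?L (\<lambda>x. f x / u x powr \<theta> * \<eta> x) \<and>
        (LINT x|?L. a x * (weak_grad \<Omega> u x \<bullet> classical_grad \<eta> x))
          + (LINT x|?L. \<psi> x * \<bar>u x\<bar> powr (r - 2) * u x * \<eta> x)
          = (LINT x|?L. f x / u x powr \<theta> * \<eta> x)"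
      using sol unfolding is_solution_def by blast
  qed
  show "J_functional \<Omega> a M f r \<theta> u \<phi> \<le> J_functional \<Omega> a M f r \<theta> u \<psi> \<and>
        J_functional \<Omega> a M f r \<theta> u \<psi> \<le> J_functional \<Omega> a M f r \<theta> v \<psi>"
  proof
    show "J_functional \<Omega> a M f r \<theta> u \<phi> \<le> J_functional \<Omega> a M f r \<theta> u \<psi>"
      unfolding J_functional_def using maximal(1)[OF \<phi>] maximal(1)[OF \<psi>(1)] maximal(2)[OF \<phi>] by simp
    show "J_functional \<Omega> a M f r \<theta> u \<psi> \<le> J_functional \<Omega> a M f r \<theta> v \<psi>"
      unfolding J_functional_def using minimal \<psi>u \<psi>v by (simp add: pos[OF u(1)] pos[OF v])
  qed
qed

end
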